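(* Let $\mathfrak{s}$ be a nonzero finite-dimensional complex solvable Lie algebra with nilradical $\mathfrak{n}$, let $\mathfrak{v}$ be a vector-space complement so that $\mathfrak{s}=\mathfrak{n}\oplus\mathfrak{v}$, and let $Q_{\mathfrak{s}}(z_0,\mathbf{z})$ be its characteristic polynomial with respect to a basis adapted to this decomposition. Let $\Delta\subset\mathfrak{v}^*$ be the set of distinct nilradical weights and $m_\alpha$ the multiplicity of $\alpha\in\Delta$. Then \[ Q_{\mathfrak{s}}(z_0,\mathbf{z})=z_0^{\dim\mathfrak{v}}\prod_{\alpha\in\Delta}\bigl(z_0+\ell_\alpha(\mathbf{z}_{\mathfrak v})\bigr)^{m_\alpha}. \] Consequently, the spectral index is $\kappa(\mathfrak{s})=|\Delta\cup\{0\}|$.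
   Context: The nilradical $\mathfrak{n}=\operatorname{Nil}(\mathfrak{s})$ is the unique maximal nilpotent ideal of $\mathfrak{s}$. Put $M=\dim\mathfrak{n}$, $k=\dim\mathfrak{v}$. Nilradical weights: By Lie's theorem there is a basis of $\mathfrak{n}$ in which all operators $\operatorname{ad}(y)|_{\mathfrak{n}}$, $y\in\mathfrak{s}$, are upper triangular; the diagonal entries are linear functionals $\lambda_1,\dots,\lambda_M\in\mathfrak{s}^*$, which vanish on $\mathfrak{n}$. The nilradical weight multiset is $\Delta_{\mathfrak{s}}=\{\lambda_1|_{\mathfrak{v}},\dots,\lambda_M|_{\mathfrak{v}}\}$ counted with multiplicity (it does not depend on the triangularizing basis); $\Delta$ is its set of distinct elements and $m_\alpha$ is the multiplicity of $\alpha$. Characteristic polynomial: for a basis $x_1,\dots,x_M$ of $\mathfrak{n}$ and a basis $f_1,\dots,f_k$ of $\mathfrak{v}$, with indeterminates $\mathbf{z}=(\mathbf{z}_{\mathfrak n},\mathbf{z}_{\mathfrak v})=(z_{x_1},\dots,z_{x_M},z_{f_1},\dots,z_{f_k})$, \[Q_{\mathfrak{s}}(z_0,\mathbf{z})=\det\Bigl(z_0I+\sum_{i=1}^M z_{x_i}\operatorname{ad}(x_i)+\sum_{j=1}^k z_{f_j}\operatorname{ad}(f_j)\Bigr).\] For $\alpha\in\mathfrak{v}^*$, $\ell_\alpha(\mathbf{z}_{\mathfrak v}):=\sum_{j=1}^k\alpha(f_j)z_{f_j}$. The spectral index $\kappa(\mathfrak{s})$ is the number of distinct irreducible factors of $Q_{\mathfrak{s}}$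 (up to scalar, not counting multiplicity). *)

theory Defs
  imports
    Complex_Main
    "HOL-Library.FuncSet"
    "HOL-Library.Multiset"
    "HOL-Library.Poly_Mapping"
    "HOL-Computational_Algebra.Factorial_Ring"
    "Jordan_Normal_Form.Determinant"
begin

section \<open>Polynomials in several indeterminates\<close>

text \<open>Exponent vectors are finitely supported maps from the index of an indeterminate to its
  exponent. The indeterminates are indexed by all natural numbers; any given polynomial involves
  only finitely many of them, and its divisors, hence its irreducible factors, involve no others.\<close>

type_synonym cpoly = "(nat \<Rightarrow>\<^sub>0 nat) \<Rightarrow>\<^sub>0 complex"

definition const_poly :: "complex \<Rightarrow> cpoly" where
  "const_poly c = Poly_Mapping.single 0 c"

definition indet :: "nat \<Rightarrow> cpoly" where
  "indet i = Poly_Mapping.single (Poly_Mapping.single i 1) 1"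

definition scalar_equiv :: "(cpoly \<times> cpoly) set" where
  "scalar_equiv = {(p, q). \<exists>c. c \<noteq> 0 \<and> q = const_poly c * p}"

definition num_irreducible_factors :: "cpoly \<Rightarrow> nat" where
  "num_irreducible_factors Q = card ({p. irreducible p \<and> p dvd Q} // scalar_equiv)"


section \<open>Complex Lie algebras\<close>

text \<open>The underlying vector space is the whole type \<open>'s\<close>.\<close>

locale complex_lie_algebra = Vector_Spaces.vector_space scale
  for scale :: "complex \<Rightarrow> 's::ab_group_add \<Rightarrow> 's" +
  fixes bracket :: "'s \<Rightarrow> 's \<Rightarrow> 's"
  assumes bracket_add_left: "bracket (x + y) z = bracket x z + bracket y z"
    and bracket_add_right: "bracket x (y + z) = bracket x y + bracket x z"
    and bracket_scale_left: "bracket (scale c x) y = scale c (bracket x y)"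
    and bracket_scale_right: "bracket x (scale c y) = scale c (bracket x y)"
    and bracket_self: "bracket x x = 0"
    and jacobi: "bracket x (bracket y z) + bracket y (bracket z x) + bracket z (bracket x y) = 0"
begin

definition finite_dimensional :: bool where
  "finite_dimensional \<longleftrightarrow> (\<exists>B. finite B \<and> span B = UNIV)"

definition bracket_span :: "'s set \<Rightarrow> 's set \<Rightarrow> 's set" where
  "bracket_span A B = span {bracket x y |x y. x \<in> A \<and> y \<in> B}"

primrec derived_series :: "nat \<Rightarrow> 's set" where
  "derived_series 0 = UNIV"
| "derived_series (Suc n) = bracket_span (derived_series n) (derived_series n)"

definition solvable :: bool where
  "solvable \<longleftrightarrow> (\<exists>n. derived_series n = {0})"

definition lie_ideal :: "'s set \<Rightarrow> bool" where
  "lie_ideal I \<longleftrightarrow> subspace I \<and> (\<forall>y. \<forall>x\<in>I. bracket y x \<in> I)"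

primrec lower_central_series :: "'s set \<Rightarrow> nat \<Rightarrow> 's set" where
  "lower_central_series I 0 = I"
| "lower_central_series I (Suc n) = bracket_span I (lower_central_series I n)"

definition nilpotent_ideal :: "'s set \<Rightarrow> bool" where
  "nilpotent_ideal I \<longleftrightarrow> lie_ideal I \<and> (\<exists>n. lower_central_series I n = {0})"

definition maximal_nilpotent_ideal :: "'s set \<Rightarrow> bool" where
  "maximal_nilpotent_ideal I \<longleftrightarrow>
     nilpotent_ideal I \<and> (\<forall>J. nilpotent_ideal J \<longrightarrow> I \<subseteq> J \<longrightarrow> J = I)"

definition nilradical :: "'s set" where
  "nilradical = (THE I. maximal_nilpotent_ideal I)"

definition complement_of :: "'s set \<Rightarrow> 's set \<Rightarrow> bool" where
  "complement_of U V \<longleftrightarrow> subspace V \<and> U \<inter> V = {0} \<and> {x + y |x y. x \<in> U \<and> y \<in> V} = UNIV"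

definition ordered_basis :: "'s set \<Rightarrow> 's list \<Rightarrow> bool" where
  "ordered_basis U bs \<longleftrightarrow> distinct bs \<and> independent (set bs) \<and> span (set bs) = U"

text \<open>The matrix of \<open>ad y\<close>, restricted to the span of \<open>bs\<close>, with respect to the ordered basis
  \<open>bs\<close>: column \<open>j\<close> holds the coordinates of \<open>bracket y (bs ! j)\<close>. It is meaningful only if
  \<open>ad y\<close> preserves that span.\<close>

definition ad_matrix :: "'s list \<Rightarrow> 's \<Rightarrow> complex mat" where
  "ad_matrix bs y = mat (length bs) (length bs)
     (\<lambda>(i, j). representation (set bs) (bracket y (bs ! j)) (bs ! i))"

definition triangularizing_basis :: "'s list \<Rightarrow> bool" where
  "triangularizing_basis ws \<longleftrightarrow>
     ordered_basis nilradical ws \<and> (\<forall>y. upper_triangular (ad_matrix ws y))"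

text \<open>Elements of the dual of a subspace \<open>V\<close> are represented as functions that are
  \<^const>\<open>undefined\<close> outside \<open>V\<close>, so that equality of functionals is equality of functions.\<close>

definition diagonal_functionals :: "'s set \<Rightarrow> 's list \<Rightarrow> ('s \<Rightarrow> complex) multiset" where
  "diagonal_functionals V ws =
     mset (map (\<lambda>i. restrict (\<lambda>y. ad_matrix ws y $$ (i, i)) V) [0..<length ws])"

definition nilradical_weights :: "'s set \<Rightarrow> ('s \<Rightarrow> complex) multiset" where
  "nilradical_weights V =
     (THE W. \<exists>ws. triangularizing_basis ws \<and> W = diagonal_functionals V ws)"

text \<open>\<open>indet 0\<close> is \<open>z\<^sub>0\<close> and \<open>indet (Suc l)\<close> is the indeterminate attached to \<open>bs ! l\<close>. For the
  basis \<open>xs @ fs\<close>, the indeterminate attached to \<open>fs ! j\<close> is thus \<open>indet (Suc (length xs + j))\<close>.\<close>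

definition char_polynomial :: "'s list \<Rightarrow> cpoly" where
  "char_polynomial bs = det (mat (length bs) (length bs)
     (\<lambda>(i, j). (if i = j then indet 0 else 0) +
        (\<Sum>l<length bs. indet (Suc l) * const_poly (ad_matrix bs (bs ! l) $$ (i, j)))))"

definition spectral_index :: "'s list \<Rightarrow> nat" where
  "spectral_index bs = num_irreducible_factors (char_polynomial bs)"

end

definition weight_form :: "'s list \<Rightarrow> 's list \<Rightarrow> ('s \<Rightarrow> complex) \<Rightarrow> cpoly" where
  "weight_form xs fs \<alpha> =
     (\<Sum>j<length fs. const_poly (\<alpha> (fs ! j)) * indet (Suc (length xs + j)))"

end

theory Submission
  imports Defs "HOL-Computational_Algebra.Fundamental_Theorem_Algebra"
begin

text \<open>The theorem combines two facts. The first is Lie's theorem for the adjoint action, in the form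
  that any two nested ideals \<open>U \<subset> W\<close> admit a vector of \<open>W\<close> outside \<open>U\<close> which is a common
  eigenvector modulo \<open>U\<close> (\<open>exists_weight_vector_mod_subspace\<close>). Iterating it inside an ideal gives an
  ordered basis whose initial segments all span ideals, that is, a basis in which every \<open>ad y\<close> is upper
  triangular (\<open>exists_ad_flag_basis\<close>). Applied to the whole algebra, it identifies the nilradical as the
  set of those \<open>x\<close> for which \<open>ad x\<close> is strictly upper triangular: this set is a nilpotent ideal, and it
  contains every nilpotent ideal because \<open>ad x\<close> is nilpotent for \<open>x\<close> in such an ideal. In particular all
  commutators lie in the nilradical (\<open>nilradical_solvable\<close>).

  Hence, in a basis adapted to the nilradical and its complement \<open>V\<close>, the rows of the defining matrix
  that belong to \<open>V\<close> vanish apart from \<open>z\<^sub>0\<close> on the diagonal. This splits off \<open>z\<^sub>0 ^ dim V\<close> and leaves the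
  pencil of the restrictions to the nilradical (\<open>det_ad_pencil_block\<close>). Its determinant does not
  depend on the basis of the nilradical (\<open>det_ad_pencil_change_of_basis\<close>), so a triangularizing basis
  may be used, where the determinant is the product of the diagonal entries. The diagonal functionals vanish
  on the nilradical, so these entries are the forms \<open>z\<^sub>0 + \<ell>\<^sub>\<alpha>\<close>.

  The second fact is unique factorization for products of such linear forms. Each \<open>z\<^sub>0 + \<ell>\<^sub>\<alpha>\<close> is prime,
  since it divides a polynomial exactly when the substitution \<open>z\<^sub>0 := - \<ell>\<^sub>\<alpha>\<close> kills it, and
  different weights give forms that are not scalar multiples of each other. This shows that the multiset
  of weights is the same for all triangularizing bases (\<open>nilradical_weights_eq\<close>), and it counts the
  irreducible factors. The factor \<open>z\<^sub>0\<close> always occurs: if \<open>V\<close> is trivial, the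
  algebra is nilpotent and nonzero, and its only weight is zero.\<close>

section \<open>Polynomials in several indeterminates\<close>

lemma const_poly_0 [simp]: "const_poly 0 = 0"
  and const_poly_1 [simp]: "const_poly 1 = 1"
  and const_poly_add: "const_poly (a + b) = const_poly a + const_poly b"
  and const_poly_mult: "const_poly (a * b) = const_poly a * const_poly b"
  by (simp_all add: const_poly_def single_add mult_single)

lemma const_poly_uminus: "const_poly (- a) = - const_poly a"
  by (simp add: const_poly_def single_uminus)

lemma const_poly_sum: "const_poly (sum f A) = (\<Sum>x\<in>A. const_poly (f x))"
  by (induction A rule: infinite_finite_induct) (simp_all add: const_poly_add)

lemma lookup_const_poly_mult [simp]: "Poly_Mapping.lookup (const_poly c * p) k = c * Poly_Mapping.lookup p k"
  unfolding const_poly_def lookup_mult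
  by (simp add: lookup_single when_mult)

lemma poly_mapping_eq_sum_single:
  fixes p :: "'a \<Rightarrow>\<^sub>0 'b::comm_monoid_add"
  shows "p = (\<Sum>k\<in>Poly_Mapping.keys p. Poly_Mapping.single k (Poly_Mapping.lookup p k))"
proof (rule poly_mapping_eqI)
  fix k
  show "Poly_Mapping.lookup p k = Poly_Mapping.lookup (\<Sum>k\<in>Poly_Mapping.keys p. Poly_Mapping.single k (Poly_Mapping.lookup p k)) k"
    by (cases "k \<in> Poly_Mapping.keys p") (auto simp: lookup_sum lookup_single when_def in_keys_iff)
qed

text \<open>Nothing can cancel at a monomial that decomposes uniquely, such as the product of the largest, or of the
  smallest, monomials of the two factors with respect to a monomial order.\<close>

lemma lookup_mult_unique_decomposition:
  fixes p q :: "'a::comm_monoid_add \<Rightarrow>\<^sub>0 'b::comm_semiring_0"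
  assumes "\<And>k l. k \<in> Poly_Mapping.keys p \<Longrightarrow> l \<in> Poly_Mapping.keys q \<Longrightarrow> m + n = k + l \<Longrightarrow> k = m \<and> l = n"
  shows "Poly_Mapping.lookup (p * q) (m + n) = Poly_Mapping.lookup p m * Poly_Mapping.lookup q n"
proof -
  have "Poly_Mapping.lookup p k * (Poly_Mapping.lookup q l when m + n = k + l) =
      ((Poly_Mapping.lookup p m * Poly_Mapping.lookup q n when l = n) when k = m)" for k l
  proof (cases "Poly_Mapping.lookup p k = 0 \<or> Poly_Mapping.lookup q l = 0")
    case True
    then show ?thesis by (cases "k = m"; cases "l = n"; auto)
  next
    case False
    have "k \<in> Poly_Mapping.keys p" "l \<in> Poly_Mapping.keys q" using False by (auto simp: in_keys_iff)
    show ?thesis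
    proof (cases "k = m \<and> l = n")
      case False
      then have "m + n \<noteq> k + l"
        using assms \<open>k \<in> Poly_Mapping.keys p\<close> \<open>l \<in> Poly_Mapping.keys q\<close> by blast
      then have "(Poly_Mapping.lookup q l when m + n = k + l) = 0"
        by (simp only: when_simps)
      moreover have "((Poly_Mapping.lookup p m * Poly_Mapping.lookup q n when l = n) when k = m) = 0"
        using \<open>\<not> (k = m \<and> l = n)\<close> by (cases "k = m"; cases "l = n"; simp)
      ultimately show ?thesis by (simp only: mult_zero_right)
    qed simp
  qed
  moreover have "finite {l. (Poly_Mapping.lookup q l when m + n = k + l) \<noteq> 0}" for k
    by (rule finite_subset[of _ "Poly_Mapping.keys q"]) (auto simp: in_keys_iff)
  then have "Poly_Mapping.lookup (p * q) (m + n) = (\<Sum>k. \<Sum>l. Poly_Mapping.lookup p k * (Poly_Mapping.lookup q l when m + n = k + l))"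
    unfolding lookup_mult by (simp add: Sum_any_right_distrib)
  ultimately show ?thesis
    by (simp add: Sum_any_when_independent)
qed

text \<open>The largest monomials of two mutually inverse polynomials add up to the largest monomial of
  their product, and likewise the smallest ones. The product is \<open>1\<close> and exponents are nonnegative, so all of
  these monomials are trivial. Using both ends avoids showing that the trivial monomial is the least one in the order.\<close>

lemma unit_cpoly_const:
  assumes "(u :: cpoly) dvd 1"
  obtains c where "c \<noteq> 0" "u = const_poly c"
proof -
  from assms obtain v where uv: "u * v = 1" by (metis dvdE)
  let ?K = "Poly_Mapping.keys u" and ?M = "Poly_Mapping.keys v"
  from uv have nz: "?K \<noteq> {}" "?M \<noteq> {}" by auto
  have one: "Poly_Mapping.lookup (u * v) k \<noteq> 0 \<Longrightarrow> k = 0" for k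
    using uv by (auto simp: lookup_one when_def split: if_splits)
  have "Max ?K + Max ?M = 0"
  proof (rule one)
    have "Poly_Mapping.lookup (u * v) (Max ?K + Max ?M) =
        Poly_Mapping.lookup u (Max ?K) * Poly_Mapping.lookup v (Max ?M)"
    proof (rule lookup_mult_unique_decomposition)
      fix k l assume "k \<in> ?K" "l \<in> ?M" and eq: "Max ?K + Max ?M = k + l"
      then have "k \<le> Max ?K" "l \<le> Max ?M" by auto
      then show "k = Max ?K \<and> l = Max ?M"
        using eq by (metis add_less_le_mono add_le_less_mono order_le_less less_irrefl)
    qed
    then show "Poly_Mapping.lookup (u * v) (Max ?K + Max ?M) \<noteq> 0"
      using Max_in[OF finite_keys nz(1)] Max_in[OF finite_keys nz(2)] by (simp add: in_keys_iff)
  qed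
  moreover have "Min ?K + Min ?M = 0"
  proof (rule one)
    have "Poly_Mapping.lookup (u * v) (Min ?K + Min ?M) =
        Poly_Mapping.lookup u (Min ?K) * Poly_Mapping.lookup v (Min ?M)"
    proof (rule lookup_mult_unique_decomposition)
      fix k l assume "k \<in> ?K" "l \<in> ?M" and eq: "Min ?K + Min ?M = k + l"
      then have "Min ?K \<le> k" "Min ?M \<le> l" by auto
      then show "k = Min ?K \<and> l = Min ?M"
        using eq by (metis add_less_le_mono add_le_less_mono order_le_less less_irrefl)
    qed
    then show "Poly_Mapping.lookup (u * v) (Min ?K + Min ?M) \<noteq> 0"
      using Min_in[OF finite_keys nz(1)] Min_in[OF finite_keys nz(2)] by (simp add: in_keys_iff)
  qed
  moreover have nat0: "a + b = 0 \<Longrightarrow> a = 0" for a b :: "nat \<Rightarrow>\<^sub>0 nat"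
    by (metis add_eq_0_iff_both_eq_0 lookup_add lookup_zero poly_mapping_eqI)
  ultimately have "Max ?K = 0" "Min ?K = 0"
    by (auto dest: nat0)
  then have "k \<in> ?K \<Longrightarrow> k = 0" for k
    using Max_ge[OF finite_keys, of k u] Min_le[OF finite_keys, of k u] by simp
  with nz have k0: "?K = {0}" by blast
  then have "u = const_poly (Poly_Mapping.lookup u 0)"
    using poly_mapping_eq_sum_single[of u] by (simp add: const_poly_def)
  moreover have "Poly_Mapping.lookup u 0 \<noteq> 0" using k0 by (auto simp flip: in_keys_iff)
  ultimately show thesis using that by blast
qed

text \<open>The linear extension of a map on monomials. It is multiplicative as soon as the map on monomials
  is.\<close>

definition extend_monomials :: "((nat \<Rightarrow>\<^sub>0 nat) \<Rightarrow> cpoly) \<Rightarrow> cpoly \<Rightarrow> cpoly" where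
  "extend_monomials h p = (\<Sum>k\<in>Poly_Mapping.keys p. const_poly (Poly_Mapping.lookup p k) * h k)"

lemma extend_monomials_superset:
  assumes "finite A" "Poly_Mapping.keys p \<subseteq> A"
  shows "extend_monomials h p = (\<Sum>k\<in>A. const_poly (Poly_Mapping.lookup p k) * h k)"
  unfolding extend_monomials_def
  by (rule sum.mono_neutral_left) (use assms in \<open>auto simp: in_keys_iff\<close>)

lemma extend_monomials_add:
  "extend_monomials h (p + q) = extend_monomials h p + extend_monomials h q"
proof -
  let ?A = "Poly_Mapping.keys p \<union> Poly_Mapping.keys q"
  have "Poly_Mapping.keys (p + q) \<subseteq> ?A" by (rule keys_add)
  then show ?thesis
    by (simp add: extend_monomials_superset[where A = ?A] lookup_add const_poly_add
        distrib_right sum.distrib)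
qed

lemma extend_monomials_0 [simp]: "extend_monomials h 0 = 0"
  by (simp add: extend_monomials_def)

lemma extend_monomials_sum: "extend_monomials h (sum f A) = (\<Sum>x\<in>A. extend_monomials h (f x))"
  by (induction A rule: infinite_finite_induct) (simp_all add: extend_monomials_add)

lemma extend_monomials_single [simp]:
  "extend_monomials h (Poly_Mapping.single k c) = const_poly c * h k"
  by (simp add: extend_monomials_superset[where A = "{k}"])

lemma extend_monomials_mult:
  assumes "\<And>k l. h (k + l) = h k * h l"
  shows "extend_monomials h (p * q) = extend_monomials h p * extend_monomials h q"
proof -
  have "p * q = (\<Sum>k\<in>Poly_Mapping.keys p. \<Sum>l\<in>Poly_Mapping.keys q. Poly_Mapping.single (k + l) (Poly_Mapping.lookup p k * Poly_Mapping.lookup q l))"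
    using arg_cong2[OF poly_mapping_eq_sum_single[of p] poly_mapping_eq_sum_single[of q], of "(*)"]
    by (simp only: sum_product mult_single)
  then have "extend_monomials h (p * q) = (\<Sum>k\<in>Poly_Mapping.keys p. \<Sum>l\<in>Poly_Mapping.keys q.
      (const_poly (Poly_Mapping.lookup p k) * h k) * (const_poly (Poly_Mapping.lookup q l) * h l))"
    by (simp add: extend_monomials_sum assms const_poly_mult ac_simps)
  then show ?thesis
    by (simp add: extend_monomials_def sum_product)
qed

text \<open>The ring endomorphism that sends \<open>indet 0\<close> to \<open>a\<close> and fixes all other indeterminates.\<close>

definition subst_indet0 :: "cpoly \<Rightarrow> cpoly \<Rightarrow> cpoly" where
  "subst_indet0 a = extend_monomials (\<lambda>k. a ^ Poly_Mapping.lookup k 0 *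
     Poly_Mapping.single (k - Poly_Mapping.single 0 (Poly_Mapping.lookup k 0)) 1)"

lemma subst_indet0_add: "subst_indet0 a (p + q) = subst_indet0 a p + subst_indet0 a q"
  and subst_indet0_0 [simp]: "subst_indet0 a 0 = 0"
  and subst_indet0_sum: "subst_indet0 a (sum f A) = (\<Sum>x\<in>A. subst_indet0 a (f x))"
  by (simp_all add: subst_indet0_def extend_monomials_add extend_monomials_sum)

lemma subst_indet0_mult: "subst_indet0 a (p * q) = subst_indet0 a p * subst_indet0 a q"
  unfolding subst_indet0_def
proof (rule extend_monomials_mult)
  fix k l :: "nat \<Rightarrow>\<^sub>0 nat"
  have "k + l - Poly_Mapping.single 0 (Poly_Mapping.lookup (k + l) 0) =
      (k - Poly_Mapping.single 0 (Poly_Mapping.lookup k 0)) + (l - Poly_Mapping.single 0 (Poly_Mapping.lookup l 0))"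
    by (rule poly_mapping_eqI) (auto simp: lookup_add lookup_minus lookup_single when_def)
  then show "a ^ Poly_Mapping.lookup (k + l) 0 * Poly_Mapping.single (k + l - Poly_Mapping.single 0 (Poly_Mapping.lookup (k + l) 0)) 1 =
    a ^ Poly_Mapping.lookup k 0 * Poly_Mapping.single (k - Poly_Mapping.single 0 (Poly_Mapping.lookup k 0)) 1 *
    (a ^ Poly_Mapping.lookup l 0 * Poly_Mapping.single (l - Poly_Mapping.single 0 (Poly_Mapping.lookup l 0)) 1)"
    by (simp add: lookup_add power_add mult_single ac_simps)
qed

lemma subst_indet0_const [simp]: "subst_indet0 a (const_poly c) = const_poly c"
  by (simp add: subst_indet0_def const_poly_def)

lemma subst_indet0_indet [simp]:
  "subst_indet0 a (indet 0) = a" "subst_indet0 a (indet (Suc i)) = indet (Suc i)"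
  by (simp_all add: subst_indet0_def indet_def lookup_single minus_poly_mapping.rep_eq)

lemma indet_power: "indet i ^ n = Poly_Mapping.single (Poly_Mapping.single i n) 1"
  by (induction n) (simp_all add: indet_def mult_single single_add[symmetric])

text \<open>Monomial by monomial, this is the divisibility of \<open>z\<^sub>0 ^ n - a ^ n\<close> by \<open>z\<^sub>0 - a\<close>.\<close>

lemma dvd_diff_subst_indet0: "indet 0 - a dvd p - subst_indet0 a p"
proof -
  define h where "h k = Poly_Mapping.single (k - Poly_Mapping.single 0 (Poly_Mapping.lookup k 0)) (1::complex)"
    for k :: "nat \<Rightarrow>\<^sub>0 nat"
  have single: "Poly_Mapping.single k c = const_poly c * (indet 0 ^ Poly_Mapping.lookup k 0 * h k)" for k c
  proof -
    have "Poly_Mapping.single 0 (Poly_Mapping.lookup k 0) + (k - Poly_Mapping.single 0 (Poly_Mapping.lookup k 0)) = k"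
      by (rule poly_mapping_eqI) (auto simp: lookup_add lookup_minus lookup_single when_def)
    then show ?thesis
      by (simp add: indet_power h_def mult_single const_poly_def)
  qed
  have "p - subst_indet0 a p =
      (\<Sum>k\<in>Poly_Mapping.keys p. const_poly (Poly_Mapping.lookup p k) * h k * (indet 0 ^ Poly_Mapping.lookup k 0 - a ^ Poly_Mapping.lookup k 0))"
  proof -
    have "p - subst_indet0 a p = (\<Sum>k\<in>Poly_Mapping.keys p. Poly_Mapping.single k (Poly_Mapping.lookup p k))
        - (\<Sum>k\<in>Poly_Mapping.keys p. const_poly (Poly_Mapping.lookup p k) * (a ^ Poly_Mapping.lookup k 0 * h k))"
      using poly_mapping_eq_sum_single[of p]
      unfolding subst_indet0_def extend_monomials_def h_def by (simp only:)
    then show ?thesis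
      unfolding single by (simp only: sum_subtractf[symmetric] right_diff_distrib ac_simps)
  qed
  moreover have "indet 0 - a dvd indet 0 ^ n - a ^ n" for n
    by (simp add: power_diff_sumr2)
  ultimately show ?thesis by (auto intro!: dvd_sum)
qed

text \<open>The form generates the kernel of the substitution \<open>z\<^sub>0 := a\<close>, and the kernel of a ring
  homomorphism into an integral domain is a prime ideal. The hypothesis that \<open>a\<close> is
  fixed by the substitution expresses that \<open>a\<close> does not involve \<open>z\<^sub>0\<close>.\<close>

lemma prime_elem_indet0_minus:
  assumes "subst_indet0 a a = a" "indet 0 \<noteq> a"
  shows "prime_elem (indet 0 - a)"
proof -
  let ?L = "indet 0 - a"
  have "subst_indet0 a ?L = 0"
    using subst_indet0_add[of a ?L a] assms by simp
  then have dvd_iff: "?L dvd p \<longleftrightarrow> subst_indet0 a p = 0" for p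
    using dvd_diff_subst_indet0[of a p] by (auto simp: subst_indet0_mult)
  have "subst_indet0 a 1 = 1"
    using subst_indet0_const[of a 1] by simp
  then show ?thesis
    using assms(2) by (auto simp: prime_elem_def dvd_iff subst_indet0_mult)
qed

section \<open>Products of linear forms\<close>

lemma lookup_indet [simp]:
  "Poly_Mapping.lookup (indet i) (Poly_Mapping.single j (Suc 0)) = (if i = j then 1 else 0)"
proof -
  have "Poly_Mapping.single i (1::nat) = Poly_Mapping.single j 1 \<longleftrightarrow> i = j"
    by (metis lookup_single_eq lookup_single_not_eq zero_neq_one)
  then show ?thesis by (simp add: indet_def lookup_single when_def)
qed

lemma lookup_weight_form_indet0 [simp]:
  "Poly_Mapping.lookup (weight_form xs fs \<alpha>) (Poly_Mapping.single 0 (Suc 0)) = 0"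
  by (simp add: weight_form_def lookup_sum)

lemma lookup_weight_form_indet:
  assumes "j < length fs"
  shows "Poly_Mapping.lookup (weight_form xs fs \<alpha>) (Poly_Mapping.single (Suc (length xs + j)) (Suc 0)) = \<alpha> (fs ! j)"
proof -
  have "Poly_Mapping.lookup (weight_form xs fs \<alpha>) (Poly_Mapping.single (Suc (length xs + j)) (Suc 0)) =
      (\<Sum>i<length fs. if i = j then \<alpha> (fs ! i) else 0)"
    unfolding weight_form_def lookup_sum
    by (rule sum.cong) auto
  with assms show ?thesis by simp
qed

definition monic_weight_form :: "'s list \<Rightarrow> 's list \<Rightarrow> ('s \<Rightarrow> complex) \<Rightarrow> cpoly" where
  "monic_weight_form xs fs \<alpha> = indet 0 + weight_form xs fs \<alpha>"

lemma lookup_monic_weight_form: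
  "Poly_Mapping.lookup (monic_weight_form xs fs \<alpha>) (Poly_Mapping.single 0 (Suc 0)) = 1"
  "j < length fs \<Longrightarrow>
    Poly_Mapping.lookup (monic_weight_form xs fs \<alpha>) (Poly_Mapping.single (Suc (length xs + j)) (Suc 0)) = \<alpha> (fs ! j)"
  by (simp_all add: monic_weight_form_def lookup_add lookup_weight_form_indet)

lemma prime_elem_monic_weight_form: "prime_elem (monic_weight_form xs fs \<alpha>)"
proof -
  define a where "a = - weight_form xs fs \<alpha>"
  have a: "a = (\<Sum>j<length fs. const_poly (- \<alpha> (fs ! j)) * indet (Suc (length xs + j)))"
    by (simp add: a_def weight_form_def const_poly_uminus sum_negf)
  have "subst_indet0 a a = a"
  proof -
    have "subst_indet0 b a = a" for b
      unfolding a by (simp add: subst_indet0_sum subst_indet0_mult)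
    then show ?thesis .
  qed
  moreover have "indet 0 \<noteq> a"
    using lookup_monic_weight_form(1)[of xs fs \<alpha>] by (auto simp: a_def monic_weight_form_def)
  ultimately show ?thesis
    using prime_elem_indet0_minus[of a] by (simp add: a_def monic_weight_form_def)
qed

lemma irreducible_multiple_const:
  assumes "prime_elem p" "irreducible q" "p dvd q"
  obtains c where "c \<noteq> 0" "q = const_poly c * p"
proof -
  from assms(3) obtain u where u: "q = p * u" by (rule dvdE)
  with assms have "u dvd 1" by (auto simp: irreducible_def prime_elem_def)
  then show thesis using that u by (metis unit_cpoly_const mult.commute)
qed

lemma irreducible_if_prime_elem:
  assumes "prime_elem (p :: cpoly)"
  shows "irreducible p"
proof (rule irreducibleI)
  fix a b assume ab: "p = a * b"
  have *: "d dvd 1" if "p = c * d" "p dvd c" for c d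
  proof -
    from that(2) obtain r where "c = p * r" by (rule dvdE)
    with that(1) have "p * (r * d) = p * 1" by (simp add: ac_simps)
    then have "1 = r * d" using assms by (simp add: prime_elem_def del: mult_1_right)
    then show ?thesis by (metis dvd_triv_right)
  qed
  from ab assms have "p dvd a \<or> p dvd b" by (metis dvd_refl prime_elem_dvd_mult_iff)
  then show "a dvd 1 \<or> b dvd 1"
    using *[OF ab] *[OF ab[unfolded mult.commute[of a]]] by blast
qed (use assms in \<open>auto simp: prime_elem_def\<close>)

lemma irreducible_dvd_prod_primes:
  assumes "irreducible p" "p dvd prod_mset (image_mset L W)"
    and "\<And>\<alpha>. \<alpha> \<in># W \<Longrightarrow> prime_elem (L \<alpha>)"
  shows "\<exists>\<alpha>\<in>#W. \<exists>c. c \<noteq> 0 \<and> p = const_poly c * L \<alpha>"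
  using assms(2,3)
proof (induction W)
  case empty
  then show ?case using assms(1) by (simp add: irreducible_def)
next
  case (add \<alpha> W)
  then obtain q where q: "L \<alpha> * prod_mset (image_mset L W) = p * q" by (auto elim: dvdE)
  have prime: "prime_elem (L \<alpha>)" using add.prems by simp
  show ?case
  proof (cases "L \<alpha> dvd p")
    case True
    then show ?thesis using irreducible_multiple_const[OF prime assms(1)] by auto
  next
    case False
    moreover have "L \<alpha> dvd p * q" using q by (metis dvd_triv_left)
    ultimately obtain r where "q = L \<alpha> * r" using prime by (meson dvdE prime_elem_dvd_mult_iff)
    with q have "L \<alpha> * prod_mset (image_mset L W) = L \<alpha> * (p * r)" by (simp add: ac_simps)
    with prime have "p dvd prod_mset (image_mset L W)" by (simp add: prime_elem_def)
    then show ?thesis using add by auto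
  qed
qed

text \<open>Each prime of the first product divides the second one, so it is a scalar multiple of one of its
  factors, hence equal to that factor, and both can be cancelled.\<close>

lemma prod_primes_unique:
  assumes "prod_mset (image_mset L W) = prod_mset (image_mset L W')"
    and "\<And>\<alpha>. \<alpha> \<in># W + W' \<Longrightarrow> prime_elem (L \<alpha>)"
    and "\<And>\<alpha> \<beta> c. \<alpha> \<in># W + W' \<Longrightarrow> \<beta> \<in># W + W' \<Longrightarrow> L \<alpha> = const_poly c * L \<beta> \<Longrightarrow> \<alpha> = \<beta>"
  shows "W = W'"
  using assms
proof (induction W arbitrary: W')
  case empty
  show ?case
  proof (cases W')
    case (add \<alpha> U)
    then have "L \<alpha> dvd 1" using empty.prems(1) by (auto intro: dvdI[of _ _ "prod_mset (image_mset L U)"])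
    then show ?thesis using empty.prems(2)[of \<alpha>] add by (simp add: prime_elem_def)
  qed simp
next
  case (add \<alpha> W)
  have prime: "prime_elem (L \<alpha>)" using add.prems(2) by simp
  have "L \<alpha> dvd prod_mset (image_mset L W')" using add.prems(1) by (metis dvd_triv_left image_mset_add_mset prod_mset.add_mset)
  then obtain \<beta> c where "\<beta> \<in># W'" "L \<alpha> = const_poly c * L \<beta>"
    using irreducible_dvd_prod_primes[OF irreducible_if_prime_elem[OF prime], of L W'] add.prems(2) by auto
  then have "\<alpha> \<in># W'" using add.prems(3)[of \<alpha> \<beta> c] by simp
  then obtain U where U: "W' = add_mset \<alpha> U" by (meson mset_add)
  have "prod_mset (image_mset L W) = prod_mset (image_mset L U)"
    using add.prems(1) prime by (simp add: U prime_elem_def)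
  moreover have "W = U" if "prod_mset (image_mset L W) = prod_mset (image_mset L U)"
    by (rule add.IH[OF that]) (use add.prems(2,3) U in auto)
  ultimately show ?case by (simp add: U)
qed

lemma equiv_scalar_equiv: "equiv UNIV scalar_equiv"
proof (rule equivI)
  show "refl scalar_equiv"
    by (rule refl_onI) (auto simp: scalar_equiv_def intro: exI[of _ 1])
  show "sym scalar_equiv"
  proof (rule symI)
    fix p q assume "(p, q) \<in> scalar_equiv"
    then obtain c where "c \<noteq> 0" "q = const_poly c * p" by (auto simp: scalar_equiv_def)
    then have "p = const_poly (1 / c) * q"
      by (simp add: mult.assoc[symmetric] const_poly_mult[symmetric])
    then show "(q, p) \<in> scalar_equiv"
      using \<open>c \<noteq> 0\<close> unfolding scalar_equiv_def by (auto intro!: exI[of _ "1 / c"])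
  qed
  show "trans scalar_equiv"
  proof (rule transI)
    fix p q r assume "(p, q) \<in> scalar_equiv" "(q, r) \<in> scalar_equiv"
    then obtain c d where "c \<noteq> 0" "q = const_poly c * p" "d \<noteq> 0" "r = const_poly d * q"
      by (auto simp: scalar_equiv_def)
    then have "d * c \<noteq> 0 \<and> r = const_poly (d * c) * p" by (simp add: const_poly_mult mult.assoc)
    then show "(p, r) \<in> scalar_equiv" by (auto simp only: scalar_equiv_def mem_Collect_eq case_prod_conv)
  qed
qed simp_all

text \<open>An irreducible divisor of a product of primes is a scalar multiple of one of them, so the classes
  counted by the number of irreducible factors are those of the distinct \<open>L \<alpha>\<close>.\<close>

lemma num_irreducible_factors_prod_primes:
  assumes prime: "\<And>\<alpha>. \<alpha> \<in># W \<Longrightarrow> prime_elem (L \<alpha>)"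
    and inj: "\<And>\<alpha> \<beta> c. \<alpha> \<in># W \<Longrightarrow> \<beta> \<in># W \<Longrightarrow> L \<alpha> = const_poly c * L \<beta> \<Longrightarrow> \<alpha> = \<beta>"
  shows "num_irreducible_factors (prod_mset (image_mset L W)) = card (set_mset W)"
proof -
  let ?Q = "prod_mset (image_mset L W)"
  let ?c = "\<lambda>\<alpha>. scalar_equiv `` {L \<alpha>}"
  have "{p. irreducible p \<and> p dvd ?Q} // scalar_equiv = ?c ` set_mset W"
  proof (intro equalityI subsetI)
    fix X assume "X \<in> {p. irreducible p \<and> p dvd ?Q} // scalar_equiv"
    then obtain p where p: "irreducible p" "p dvd ?Q" "X = scalar_equiv `` {p}"
      by (auto elim: quotientE)
    then obtain \<alpha> c where "\<alpha> \<in># W" "c \<noteq> 0" "p = const_poly c * L \<alpha>"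
      using irreducible_dvd_prod_primes[OF p(1,2) prime] by auto
    then have "(L \<alpha>, p) \<in> scalar_equiv" by (auto simp: scalar_equiv_def)
    then have "X = ?c \<alpha>"
      using p(3) equiv_class_eq[OF equiv_scalar_equiv] by simp
    then show "X \<in> ?c ` set_mset W"
      using \<open>\<alpha> \<in># W\<close> by blast
  next
    fix X assume "X \<in> ?c ` set_mset W"
    then obtain \<alpha> where "\<alpha> \<in># W" "X = ?c \<alpha>" by auto
    moreover from this have "L \<alpha> dvd ?Q" by (metis dvd_prod_mset image_eqI set_image_mset)
    ultimately show "X \<in> {p. irreducible p \<and> p dvd ?Q} // scalar_equiv"
      using irreducible_if_prime_elem[OF prime] by (auto intro: quotientI)
  qed
  moreover have "inj_on ?c (set_mset W)"
  proof (rule inj_onI)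
    fix \<alpha> \<beta> assume "\<alpha> \<in># W" "\<beta> \<in># W" "?c \<alpha> = ?c \<beta>"
    moreover from this have "(L \<beta>, L \<alpha>) \<in> scalar_equiv"
      using equiv_class_eq_iff[OF equiv_scalar_equiv] by (metis UNIV_I)
    ultimately show "\<alpha> = \<beta>" using inj by (auto simp: scalar_equiv_def)
  qed
  ultimately show ?thesis unfolding num_irreducible_factors_def by (simp add: card_image)
qed

context complex_lie_algebra
begin

section \<open>Lie's theorem\<close>

lemma bracket_0_left [simp]: "bracket 0 y = 0"
  using bracket_scale_left[of 0 0 y] by simp

lemma bracket_0_right [simp]: "bracket y 0 = 0"
  using bracket_scale_right[of y 0 0] by simp

lemma bracket_diff_left: "bracket (x - y) z = bracket x z - bracket y z"
  by (metis add_diff_cancel_right' bracket_add_left diff_add_cancel)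

lemma bracket_diff_right: "bracket z (x - y) = bracket z x - bracket z y"
  by (metis add_diff_cancel_right' bracket_add_right diff_add_cancel)

lemma bracket_antisym: "bracket x y = - bracket y x"
proof -
  have "bracket x y + bracket y x = bracket (x + y) (x + y)"
    by (simp only: bracket_add_left bracket_add_right) (simp add: bracket_self)
  then have "bracket x y + bracket y x = 0" by (simp only: bracket_self)
  then show ?thesis by (simp add: eq_neg_iff_add_eq_0)
qed

lemma bracket_neg_right: "bracket x (- y) = - bracket x y"
  using bracket_diff_right[of x 0 y] by simp

text \<open>The Jacobi identity, read as: \<open>ad y\<close> is a derivation.\<close>

lemma bracket_derivation:
  "bracket y (bracket x w) = bracket x (bracket y w) + bracket (bracket y x) w"
proof -
  have "bracket y (bracket x w) + bracket x (bracket w y) + bracket w (bracket y x) = 0"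
    by (rule jacobi)
  moreover have "bracket x (bracket w y) = - bracket x (bracket y w)"
    by (metis bracket_antisym bracket_neg_right)
  moreover have "bracket w (bracket y x) = - bracket (bracket y x) w"
    by (rule bracket_antisym)
  ultimately show ?thesis by (simp add: algebra_simps)
qed

lemma bracket_sum_right: "bracket x (sum f A) = (\<Sum>a\<in>A. bracket x (f a))"
  by (induction A rule: infinite_finite_induct) (simp_all add: bracket_add_right)

lemma subspace_diff_cancel: "subspace S \<Longrightarrow> a - b \<in> S \<Longrightarrow> b \<in> S \<Longrightarrow> a \<in> S"
  using subspace_add[of S "a - b" b] by simp

lemma subspace_bracket_preimage:
  assumes "subspace U"
  shows "subspace {w. bracket y w - scale c w \<in> U}"
proof (rule subspaceI)
  show "0 \<in> {w. bracket y w - scale c w \<in> U}" using assms by (simp add: subspace_0)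
next
  fix a b assume "a \<in> {w. bracket y w - scale c w \<in> U}" "b \<in> {w. bracket y w - scale c w \<in> U}"
  then have "(bracket y a - scale c a) + (bracket y b - scale c b) \<in> U"
    using assms by (simp add: subspace_add)
  then show "a + b \<in> {w. bracket y w - scale c w \<in> U}"
    by (simp add: bracket_add_right scale_right_distrib algebra_simps)
next
  fix k a assume "a \<in> {w. bracket y w - scale c w \<in> U}"
  then have "scale k (bracket y a - scale c a) \<in> U"
    using assms by (simp add: subspace_scale)
  then show "scale k a \<in> {w. bracket y w - scale c w \<in> U}"
    by (simp add: bracket_scale_right scale_right_diff_distrib mult.commute)
qed

text \<open>Krylov spaces relative to \<open>U\<close>. They increase with \<open>n\<close>; the space at which they become stationary is invariant under \<open>ad x\<close> if \<open>U\<close> is.\<close>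

definition krylov :: "'s set \<Rightarrow> 's \<Rightarrow> 's \<Rightarrow> nat \<Rightarrow> 's set" where
  "krylov U x w n = span (U \<union> (\<lambda>i. (bracket x ^^ i) w) ` {..<n})"

lemma krylov_mono: "m \<le> n \<Longrightarrow> krylov U x w m \<subseteq> krylov U x w n"
  unfolding krylov_def by (rule span_mono) auto

lemma subspace_krylov [simp]: "subspace (krylov U x w n)"
  by (simp add: krylov_def)

lemma krylov_base: "u \<in> U \<Longrightarrow> u \<in> krylov U x w n"
  by (simp add: krylov_def span_base)

lemma krylov_power: "i < n \<Longrightarrow> (bracket x ^^ i) w \<in> krylov U x w n"
  by (simp add: krylov_def span_base)

lemma krylov_0: "subspace U \<Longrightarrow> krylov U x w 0 = U"
  by (simp add: krylov_def span_eq_iff)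

lemma bracket_krylov:
  assumes "\<And>u. u \<in> U \<Longrightarrow> bracket x u \<in> U" "r \<in> krylov U x w n"
  shows "bracket x r \<in> krylov U x w (Suc n)"
proof -
  have "krylov U x w n \<subseteq> {r. bracket x r - scale 0 r \<in> krylov U x w (Suc n)}"
    unfolding krylov_def[of _ _ _ n]
  proof (rule span_minimal)
    have "bracket x ((bracket x ^^ i) w) \<in> krylov U x w (Suc n)" if "i < n" for i
      using krylov_power[of "Suc i" "Suc n" x w U] that by simp
    then show "U \<union> (\<lambda>i. (bracket x ^^ i) w) ` {..<n} \<subseteq> {r. bracket x r - scale 0 r \<in> krylov U x w (Suc n)}"
      using assms(1) by (auto intro: krylov_base)
    show "subspace {r. bracket x r - scale 0 r \<in> krylov U x w (Suc n)}"
      by (rule subspace_bracket_preimage) simp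
  qed
  then show ?thesis using assms(2) by auto
qed

text \<open>Otherwise the iterates of \<open>w\<close> would form an infinite independent family.\<close>

lemma krylov_stabilizes:
  assumes "finite_dimensional"
  shows "\<exists>n. (bracket x ^^ n) w \<in> krylov U x w n"
proof (rule ccontr)
  assume "\<not> ?thesis"
  then have new: "(bracket x ^^ n) w \<notin> krylov U x w n" for n by auto
  obtain B where B: "finite B" "span B = UNIV" using assms by (auto simp: finite_dimensional_def)
  have "independent ((\<lambda>i. (bracket x ^^ i) w) ` {..<n}) \<and> card ((\<lambda>i. (bracket x ^^ i) w) ` {..<n}) = n" for n
  proof (induction n)
    case (Suc n)
    let ?A = "(\<lambda>i. (bracket x ^^ i) w) ` {..<n}"
    have notin: "(bracket x ^^ n) w \<notin> span ?A"
      using new[of n] span_mono[of ?A "U \<union> ?A"] unfolding krylov_def by blast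
    then have "(bracket x ^^ n) w \<notin> ?A" using span_base[of _ ?A] by blast
    moreover have "(\<lambda>i. (bracket x ^^ i) w) ` {..<Suc n} = insert ((bracket x ^^ n) w) ?A"
      by (simp add: lessThan_Suc)
    moreover have "independent (insert ((bracket x ^^ n) w) ?A)"
      using Suc by (intro independent_insertI[OF notin]) blast
    ultimately show ?case
      using Suc by (simp only: card_insert_disjoint finite_imageI finite_lessThan simp_thms)
  qed (simp add: independent_empty)
  then show False
    using independent_span_bound[OF B(1), of "(\<lambda>i. (bracket x ^^ i) w) ` {..<Suc (card B)}"] B(2) by auto
qed

text \<open>Let \<open>h\<close> act on \<open>w\<close> modulo \<open>U\<close> by the weight \<open>\<mu>\<close>. Commuting \<open>ad y\<close> past \<open>i\<close> copies of \<open>ad x\<close>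
  produces \<open>i\<close> commutator terms, each of which contributes \<open>\<mu> (bracket y x)\<close> times the previous iterate,
  up to lower order. This tracks the first superdiagonal of a triangular action. For \<open>i = 0\<close> the index \<open>i - 1\<close> is \<open>0\<close>, which is harmless because the coefficient is zero and
  the first subspace is \<open>U\<close> itself.\<close>

lemma ad_weight_mod_krylov:
  assumes U: "subspace U" "\<And>y u. y \<in> g \<Longrightarrow> u \<in> U \<Longrightarrow> bracket y u \<in> U"
    and h: "h \<subseteq> g" "\<And>y. y \<in> h \<Longrightarrow> bracket y x \<in> h" and x: "x \<in> g"
    and w: "\<And>y. y \<in> h \<Longrightarrow> bracket y w - scale (\<mu> y) w \<in> U"
    and y: "y \<in> h"
  shows "bracket y ((bracket x ^^ i) w) - scale (\<mu> y) ((bracket x ^^ i) w)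
      - scale (of_nat i * \<mu> (bracket y x)) ((bracket x ^^ (i - 1)) w) \<in> krylov U x w (i - 1)"
  using y
proof (induction i arbitrary: y)
  case 0
  then show ?case using w by (simp add: krylov_0 U(1))
next
  case (Suc i)
  let ?w = "\<lambda>i. (bracket x ^^ i) w"
  let ?y' = "bracket y x"
  define r where "r = bracket y (?w i) - scale (\<mu> y) (?w i) - scale (of_nat i * \<mu> ?y') (?w (i - 1))"
  define r' where "r' = bracket ?y' (?w i) - scale (\<mu> ?y') (?w i)
      - scale (of_nat i * \<mu> (bracket ?y' x)) (?w (i - 1))"
  have mono: "krylov U x w (i - 1) \<subseteq> krylov U x w i" by (rule krylov_mono) simp
  have "r \<in> krylov U x w (i - 1)" unfolding r_def by (rule Suc.IH[OF Suc.prems])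
  then have r: "bracket x r \<in> krylov U x w i"
  proof (cases i)
    case 0
    then show ?thesis using \<open>r \<in> krylov U x w (i - 1)\<close> U x by (simp add: krylov_0)
  next
    case (Suc j)
    then show ?thesis
      using bracket_krylov[of U x r w j] \<open>r \<in> krylov U x w (i - 1)\<close> U x by simp
  qed
  have "r' \<in> krylov U x w (i - 1)" unfolding r'_def by (rule Suc.IH[OF h(2)[OF Suc.prems]])
  moreover have "scale (of_nat i * \<mu> (bracket ?y' x)) (?w (i - 1)) \<in> krylov U x w i"
    by (cases i) (auto intro: subspace_scale krylov_power simp: subspace_0)
  ultimately have r': "bracket ?y' (?w i) - scale (\<mu> ?y') (?w i) \<in> krylov U x w i"
    using mono unfolding r'_def by (blast intro: subspace_diff_cancel[OF subspace_krylov])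
  have "scale (of_nat i) (bracket x (?w (i - 1))) = scale (of_nat i) (?w i)"
    by (cases i) simp_all
  then have "bracket x (scale (of_nat i * \<mu> ?y') (?w (i - 1))) = scale (of_nat i * \<mu> ?y') (?w i)"
    by (metis bracket_scale_right mult.commute scale_scale)
  moreover have "bracket y (?w i) = scale (\<mu> y) (?w i) + scale (of_nat i * \<mu> ?y') (?w (i - 1)) + r"
    by (simp add: r_def)
  ultimately have "bracket x (bracket y (?w i)) = scale (\<mu> y) (?w (Suc i)) + scale (of_nat i * \<mu> ?y') (?w i) + bracket x r"
    by (simp add: bracket_add_right bracket_scale_right)
  then have "bracket y (?w (Suc i)) - scale (\<mu> y) (?w (Suc i)) - scale (of_nat (Suc i) * \<mu> ?y') (?w i)
      = bracket x r + (bracket ?y' (?w i) - scale (\<mu> ?y') (?w i))"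
    by (simp add: bracket_derivation[of y x] distrib_right scale_left_distrib algebra_simps)
  then show ?case using r r' by (simp add: subspace_add)
qed

text \<open>The key step of Lie's theorem. At the first \<open>n\<close> for which the \<open>n\<close>th iterate depends on the
  previous ones, the operator \<open>ad y - \<mu> y\<close> maps it into the preceding subspace, since it lowers every
  earlier iterate. By the previous lemma it also maps it to \<open>n * \<mu> (bracket y x)\<close> times the last independent
  iterate, so this coefficient is zero, and in characteristic \<open>0\<close> one may divide by \<open>n\<close>. This replaces the
  classical trace argument.\<close>

lemma weight_vanishes_on_commutators:
  assumes fd: "finite_dimensional"
    and U: "subspace U" "\<And>y u. y \<in> g \<Longrightarrow> u \<in> U \<Longrightarrow> bracket y u \<in> U"
    and h: "h \<subseteq> g" "\<And>y. y \<in> h \<Longrightarrow> bracket y x \<in> h" and x: "x \<in> g"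
    and w: "\<And>y. y \<in> h \<Longrightarrow> bracket y w - scale (\<mu> y) w \<in> U" "w \<notin> U"
    and y: "y \<in> h"
  shows "\<mu> (bracket y x) = 0"
proof -
  let ?w = "\<lambda>i. (bracket x ^^ i) w"
  let ?K = "krylov U x w"
  define n where "n = (LEAST n. ?w n \<in> ?K n)"
  have n: "?w n \<in> ?K n" unfolding n_def by (rule LeastI_ex[OF krylov_stabilizes[OF fd]])
  have min: "?w m \<notin> ?K m" if "m < n" for m using that not_less_Least unfolding n_def by blast
  have "n \<noteq> 0" using n w(2) krylov_0[OF U(1)] by (cases n) auto
  then obtain m where m: "n = Suc m" by (cases n) auto
  have strong: "bracket y (?w i) - scale (\<mu> y) (?w i) - scale (of_nat i * \<mu> (bracket y x)) (?w (i - 1))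
      \<in> ?K (i - 1)" if "y \<in> h" for y i
    using that by (rule ad_weight_mod_krylov[where g = g and h = h, rotated -1]) (fact assms)+
  have weak: "bracket y (?w i) - scale (\<mu> y) (?w i) \<in> ?K i" for i
  proof -
    have "scale (of_nat i * \<mu> (bracket y x)) (?w (i - 1)) \<in> ?K i"
      by (cases i) (auto intro: subspace_scale krylov_power simp: subspace_0)
    moreover have "?K (i - 1) \<subseteq> ?K i" by (rule krylov_mono) simp
    ultimately show ?thesis
      using strong[OF y, of i] by (blast intro: subspace_diff_cancel[OF subspace_krylov])
  qed
  have "?K n \<subseteq> {v. bracket y v - scale (\<mu> y) v \<in> ?K m}"
    unfolding krylov_def[of _ _ _ n]
  proof (rule span_minimal)
    have "bracket y (?w i) - scale (\<mu> y) (?w i) \<in> ?K m" if "i < n" for i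
      using weak[of i] krylov_mono[of i m U x w] that m by auto
    moreover have "bracket y u - scale (\<mu> y) u \<in> ?K m" if "u \<in> U" for u
      using that U h(1) y by (auto intro!: krylov_base subspace_diff subspace_scale)
    ultimately show "U \<union> ?w ` {..<n} \<subseteq> {v. bracket y v - scale (\<mu> y) v \<in> ?K m}" by auto
  qed (simp add: subspace_bracket_preimage)
  then have 1: "bracket y (?w n) - scale (\<mu> y) (?w n) \<in> ?K m" using n by blast
  have "bracket y (?w n) - scale (\<mu> y) (?w n) - scale (of_nat n * \<mu> (bracket y x)) (?w m) \<in> ?K m"
    using strong[OF y, of n] by (simp add: m)
  from subspace_diff[OF subspace_krylov 1 this]
  have *: "scale (of_nat n * \<mu> (bracket y x)) (?w m) \<in> ?K m" by simp
  show ?thesis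
  proof (rule ccontr)
    assume "\<mu> (bracket y x) \<noteq> 0"
    with subspace_scale[OF subspace_krylov *, of "1 / (of_nat n * \<mu> (bracket y x))"]
    have "?w m \<in> ?K m" using \<open>n \<noteq> 0\<close> by simp
    then show False using min[of m] m by simp
  qed
qed

text \<open>The polynomial \<open>p\<close> evaluated at the operator \<open>ad z\<close> and applied to \<open>v\<close>.\<close>

definition poly_bracket :: "complex poly \<Rightarrow> 's \<Rightarrow> 's \<Rightarrow> 's" where
  "poly_bracket p z v = (\<Sum>i\<le>degree p. scale (coeff p i) ((bracket z ^^ i) v))"

lemma poly_bracket_bound:
  assumes "degree p \<le> n"
  shows "poly_bracket p z v = (\<Sum>i\<le>n. scale (coeff p i) ((bracket z ^^ i) v))"
  unfolding poly_bracket_def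
  by (rule sum.mono_neutral_left) (use assms in \<open>auto simp: coeff_eq_0\<close>)

lemma poly_bracket_add: "poly_bracket (p + q) z v = poly_bracket p z v + poly_bracket q z v"
  using degree_add_le_max[of p q]
  by (simp add: poly_bracket_bound[of _ "max (degree p) (degree q)"] scale_left_distrib sum.distrib)

lemma poly_bracket_smult: "poly_bracket (smult c p) z v = scale c (poly_bracket p z v)"
  by (simp add: poly_bracket_bound[of _ "degree p"] scale_sum_right degree_smult_le)

lemma poly_bracket_pCons_0: "poly_bracket (pCons 0 p) z v = bracket z (poly_bracket p z v)"
proof -
  have "poly_bracket (pCons 0 p) z v =
      (\<Sum>i\<le>Suc (degree p). scale (coeff (pCons 0 p) i) ((bracket z ^^ i) v))"
    by (rule poly_bracket_bound) (rule degree_pCons_le)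
  also have "\<dots> = (\<Sum>i\<le>degree p. scale (coeff p i) (bracket z ((bracket z ^^ i) v)))"
    by (simp add: sum.atMost_Suc_shift del: sum.atMost_Suc)
  also have "\<dots> = bracket z (poly_bracket p z v)"
    by (simp add: poly_bracket_def bracket_sum_right bracket_scale_right)
  finally show ?thesis .
qed

lemma poly_bracket_linear_factor:
  "poly_bracket ([:- c, 1:] * q) z v = bracket z (poly_bracket q z v) - scale c (poly_bracket q z v)"
proof -
  have "[:- c, 1:] * q = smult (- c) q + pCons 0 q" by simp
  then show ?thesis by (simp only: poly_bracket_add poly_bracket_smult poly_bracket_pCons_0) simp
qed

lemma poly_bracket_monom: "poly_bracket (monom 1 n) z v = (bracket z ^^ n) v"
proof -
  have "poly_bracket (monom 1 n) z v = (\<Sum>i\<le>n. if n = i then (bracket z ^^ i) v else 0)"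
    unfolding poly_bracket_def degree_monom_eq[OF one_neq_zero] by (rule sum.cong) auto
  then show ?thesis by simp
qed

text \<open>Modulo \<open>U\<close>, the vectors generated by \<open>n\<close> iterates are the values of the polynomials of degree less
  than \<open>n\<close>.\<close>

lemma krylov_poly_bracket:
  assumes "subspace U" "r \<in> krylov U z v n"
  shows "\<exists>q. (q = 0 \<or> degree q < n) \<and> r - poly_bracket q z v \<in> U"
proof -
  let ?S = "{r. \<exists>q. (\<forall>i\<ge>n. coeff q i = 0) \<and> r - poly_bracket q z v \<in> U}"
  have "krylov U z v n \<subseteq> ?S"
    unfolding krylov_def
  proof (rule span_minimal)
    have "u \<in> ?S" if "u \<in> U" for u
      using that by (auto intro!: exI[of _ 0] simp: poly_bracket_def)
    moreover have "(bracket z ^^ i) v \<in> ?S" if "i < n" for i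
      using that assms(1) by (auto intro!: exI[of _ "monom 1 i"] simp: poly_bracket_monom subspace_0)
    ultimately show "U \<union> (\<lambda>i. (bracket z ^^ i) v) ` {..<n} \<subseteq> ?S" by auto
    show "subspace ?S"
    proof (rule subspaceI)
      show "0 \<in> ?S" using assms(1) by (auto intro!: exI[of _ 0] simp: poly_bracket_def subspace_0)
      fix a b assume "a \<in> ?S" "b \<in> ?S"
      then obtain p q where "\<forall>i\<ge>n. coeff p i = 0" "a - poly_bracket p z v \<in> U"
        "\<forall>i\<ge>n. coeff q i = 0" "b - poly_bracket q z v \<in> U" by auto
      then have "\<forall>i\<ge>n. coeff (p + q) i = 0" "a + b - poly_bracket (p + q) z v \<in> U"
        using subspace_add[OF assms(1), of "a - poly_bracket p z v" "b - poly_bracket q z v"]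
        by (simp_all add: poly_bracket_add algebra_simps)
      then show "a + b \<in> ?S" by blast
    next
      fix c a assume "a \<in> ?S"
      then obtain p where "\<forall>i\<ge>n. coeff p i = 0" "a - poly_bracket p z v \<in> U" by auto
      then have "\<forall>i\<ge>n. coeff (smult c p) i = 0" "scale c a - poly_bracket (smult c p) z v \<in> U"
        using subspace_scale[OF assms(1), of _ c]
        by (auto simp: poly_bracket_smult scale_right_diff_distrib[symmetric])
      then show "scale c a \<in> ?S" by blast
    qed
  qed
  then obtain q where "\<forall>i\<ge>n. coeff q i = 0" "r - poly_bracket q z v \<in> U" using assms(2) by auto
  moreover from this have "q = 0 \<or> degree q < n"
    using leading_coeff_0_iff[of q] by (metis linorder_not_less)
  ultimately show ?thesis by blast
qed

text \<open>Some nonzero polynomial in \<open>ad z\<close> sends a given \<open>v\<close> outside \<open>U\<close> into \<open>U\<close>. Taking one of minimal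
  degree and splitting off a linear factor, the remaining cofactor sends \<open>v\<close> to an eigenvector modulo \<open>U\<close>.\<close>

lemma eigenvector_mod_subspace:
  assumes fd: "finite_dimensional" and U: "subspace U"
    and W: "subspace W" "\<And>u. u \<in> W \<Longrightarrow> bracket z u \<in> W"
    and "U \<subset> W"
  shows "\<exists>w\<in>W - U. \<exists>c. bracket z w - scale c w \<in> U"
proof -
  obtain v where v: "v \<in> W" "v \<notin> U" using assms by blast
  let ?P = "\<lambda>p. p \<noteq> 0 \<and> poly_bracket p z v \<in> U"
  obtain n where "(bracket z ^^ n) v \<in> krylov U z v n" using krylov_stabilizes[OF fd] by blast
  then obtain q where q: "q = 0 \<or> degree q < n" "(bracket z ^^ n) v - poly_bracket q z v \<in> U"
    using krylov_poly_bracket[OF U] by blast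
  have "coeff (monom 1 n + smult (- 1) q) n = 1"
    using q(1) by (auto simp: coeff_eq_0)
  then have "monom 1 n + smult (- 1) q \<noteq> 0" by auto
  moreover have "poly_bracket (monom 1 n + smult (- 1) q) z v \<in> U"
    using q(2) unfolding poly_bracket_add poly_bracket_smult poly_bracket_monom by simp
  ultimately have "\<exists>p. ?P p" by blast
  then obtain p where p: "?P p" and min: "\<And>q. ?P q \<Longrightarrow> degree p \<le> degree q"
    using arg_min_nat_lemma[of ?P _ degree] by blast
  have "degree p \<noteq> 0"
  proof
    assume "degree p = 0"
    then obtain a where "p = [:a:]" by (auto elim: degree_eq_zeroE)
    then have "a \<noteq> 0" "scale a v \<in> U" using p by (auto simp: poly_bracket_def)
    with subspace_scale[OF U, of "scale a v" "1 / a"] v show False by simp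
  qed
  then obtain c where "poly p c = 0"
    using fundamental_theorem_of_algebra[of p] by (auto simp: constant_degree)
  then obtain q where q: "p = [:- c, 1:] * q" by (auto simp: poly_eq_0_iff_dvd elim: dvdE)
  then have "q \<noteq> 0" using p by auto
  then have "degree p = Suc (degree q)" unfolding q by (subst degree_mult_eq) auto
  then have "poly_bracket q z v \<notin> U" using min[of q] \<open>q \<noteq> 0\<close> by auto
  moreover have "(bracket z ^^ i) v \<in> W" for i by (induction i) (use v W in auto)
  then have "poly_bracket q z v \<in> W"
    unfolding poly_bracket_def by (intro subspace_sum subspace_scale W)
  moreover have "bracket z (poly_bracket q z v) - scale c (poly_bracket q z v) \<in> U"
    using p unfolding q poly_bracket_linear_factor by simp
  ultimately show ?thesis by blast
qed

text \<open>Such a subspace lies in every term of the derived series. This is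
  how solvability enters the proof of Lie's theorem; in this form it applies directly to subalgebras.\<close>

lemma solvable_perfect_subspace_trivial:
  assumes "solvable" "g \<subseteq> bracket_span g g"
  shows "g \<subseteq> {0}"
proof -
  have "g \<subseteq> derived_series n" for n
  proof (induction n)
    case (Suc n)
    then have "bracket_span g g \<subseteq> derived_series (Suc n)"
      unfolding bracket_span_def derived_series.simps by (intro span_mono) blast
    then show ?case using assms(2) by simp
  qed simp
  then show ?thesis using assms(1) by (auto simp: solvable_def)
qed

text \<open>Lie's theorem relative to \<open>U\<close>, by induction on the dimension of the acting subalgebra. A
  nonzero subalgebra has a hyperplane \<open>span ?D\<close> containing all its commutators, which is therefore an ideal in it. By
  induction there are weight vectors for the hyperplane; for a fixed weight they form an invariant subspace
  \<open>W'\<close> because the weight vanishes on commutators, and any eigenvector in \<open>W'\<close> of one further element \<open>z\<close> is a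
  weight vector for the whole subalgebra.\<close>

lemma exists_weight_vector_mod_subspace:
  assumes fd: "finite_dimensional" and solv: "solvable"
    and g: "subspace g" "\<And>x y. x \<in> g \<Longrightarrow> y \<in> g \<Longrightarrow> bracket x y \<in> g"
    and U: "subspace U" "\<And>y u. y \<in> g \<Longrightarrow> u \<in> U \<Longrightarrow> bracket y u \<in> U"
    and W: "subspace W" "\<And>y u. y \<in> g \<Longrightarrow> u \<in> W \<Longrightarrow> bracket y u \<in> W"
    and "U \<subset> W"
  shows "\<exists>w\<in>W - U. \<exists>\<mu>. \<forall>y\<in>g. bracket y w - scale (\<mu> y) w \<in> U"
proof -
  have "\<exists>w\<in>W - U. \<exists>\<mu>. \<forall>y\<in>span B. bracket y w - scale (\<mu> y) w \<in> U"
    if "finite B" "independent B" "span B \<subseteq> g" "\<And>x y. x \<in> span B \<Longrightarrow> y \<in> span B \<Longrightarrow> bracket x y \<in> span B" for B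
    using that
  proof (induction "card B" arbitrary: B rule: less_induct)
    case less
    define g' where "g' = bracket_span (span B) (span B)"
    have g'sub: "g' \<subseteq> span B"
      unfolding g'_def bracket_span_def by (rule span_minimal) (use less.prems(4) in auto)
    show ?case
    proof (cases "B = {}")
      case True
      obtain w where "w \<in> W - U" using \<open>U \<subset> W\<close> by blast
      moreover have "\<forall>y\<in>span B. bracket y w - scale 0 w \<in> U" using True U by (simp add: subspace_0)
      ultimately show ?thesis by (intro bexI[of _ w] exI[of _ "\<lambda>_. 0"])
    next
      case False
      have "\<not> span B \<subseteq> {0}"
        using False less.prems(2) span_base[of _ B] dependent_zero by blast
      then have "\<not> span B \<subseteq> g'"
        using solvable_perfect_subspace_trivial[OF solv] unfolding g'_def by blast
      obtain C0 where C0: "C0 \<subseteq> g'" "independent C0" "g' \<subseteq> span C0"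
        by (rule maximal_independent_subset)
      have "C0 \<subseteq> span B" using C0(1) g'sub by blast
      then obtain C where C: "C0 \<subseteq> C" "C \<subseteq> span B" "independent C" "span B \<subseteq> span C"
        by (rule maximal_independent_subset_extend[OF _ C0(2)])
      have spanC: "span C = span B" using C(2,4) by (simp add: span_minimal subset_antisym)
      have finC: "finite C" "card C \<le> card B"
        using independent_span_bound[OF less.prems(1) C(3,2)] by auto
      have "span C0 \<subseteq> g'"
        by (rule span_minimal[OF C0(1)]) (simp add: g'_def bracket_span_def)
      then have "C0 \<noteq> C" using \<open>\<not> span B \<subseteq> g'\<close> spanC by blast
      then obtain z where z: "z \<in> C" "z \<notin> C0" using C(1) by blast
      let ?D = "C - {z}"
      have "C0 \<subseteq> ?D" using z C(1) by blast
      then have g'D: "g' \<subseteq> span ?D" using C0(3) span_mono by blast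
      have "span ?D \<subseteq> span B" using spanC span_mono[of ?D C] by blast
      have brD: "bracket x y \<in> span ?D" if "x \<in> span B" "y \<in> span B" for x y
        using g'D that unfolding g'_def bracket_span_def by (blast intro: span_base)
      have brDD: "bracket x y \<in> span ?D" if "x \<in> span ?D" "y \<in> span ?D" for x y
        using brD that \<open>span ?D \<subseteq> span B\<close> by blast
      have "card ?D < card B" using z finC by (meson card_Diff1_less order_less_le_trans)
      moreover have "independent ?D" using C(3) independent_mono by blast
      ultimately have "\<exists>w\<in>W - U. \<exists>\<mu>. \<forall>y\<in>span ?D. bracket y w - scale (\<mu> y) w \<in> U"
        using less.prems(3) \<open>span ?D \<subseteq> span B\<close> brDD finC(1) by (intro less.hyps) auto
      then obtain w0 \<mu> where w0: "w0 \<in> W - U" "\<And>y. y \<in> span ?D \<Longrightarrow> bracket y w0 - scale (\<mu> y) w0 \<in> U"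
        by blast
      define W' where "W' = {w \<in> W. \<forall>y\<in>span ?D. bracket y w - scale (\<mu> y) w \<in> U}"
      have zB: "z \<in> span B" using z C(2) by blast
      have "W' = W \<inter> (\<Inter>y\<in>span ?D. {w. bracket y w - scale (\<mu> y) w \<in> U})"
        by (auto simp: W'_def)
      then have W'sub: "subspace W'"
        using W(1) subspace_bracket_preimage[OF U(1)] by (auto intro!: subspace_inter subspace_Inter)
      have UW': "U \<subset> W'"
      proof
        show "U \<subseteq> W'"
          using \<open>U \<subset> W\<close> \<open>span ?D \<subseteq> span B\<close> less.prems(3)
          by (auto simp: W'_def intro!: subspace_diff U subspace_scale)
        show "U \<noteq> W'" using w0 by (auto simp: W'_def)
      qed
      have inv: "bracket z u \<in> W'" if u: "u \<in> W'" for u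
      proof -
        have "bracket y (bracket z u) - scale (\<mu> y) (bracket z u) \<in> U" if y: "y \<in> span ?D" for y
        proof (cases "u \<in> U")
          case True
          then have "bracket z u \<in> U" using U(2) zB less.prems(3) by blast
          then show ?thesis
            using y \<open>span ?D \<subseteq> span B\<close> less.prems(3) by (blast intro: subspace_diff U subspace_scale)
        next
          case False
          have "bracket y' z \<in> span ?D" if "y' \<in> span ?D" for y'
            using brD zB that \<open>span ?D \<subseteq> span B\<close> by blast
          then have "\<mu> (bracket y z) = 0"
            using weight_vanishes_on_commutators[OF fd U(1), of "span B" "span ?D" z u \<mu> y]
              U(2) less.prems(3) \<open>span ?D \<subseteq> span B\<close> zB u False y unfolding W'_def by blast
          moreover have "bracket (bracket y z) u - scale (\<mu> (bracket y z)) u \<in> U"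
            using u brD y zB \<open>span ?D \<subseteq> span B\<close> unfolding W'_def by blast
          ultimately have 1: "bracket (bracket y z) u \<in> U" by simp
          have "bracket y u - scale (\<mu> y) u \<in> U" using u y unfolding W'_def by blast
          then have 2: "bracket z (bracket y u - scale (\<mu> y) u) \<in> U"
            using U(2) zB less.prems(3) by blast
          have "bracket y (bracket z u) - scale (\<mu> y) (bracket z u)
              = bracket z (bracket y u - scale (\<mu> y) u) + bracket (bracket y z) u"
            by (simp add: bracket_derivation[of y z] bracket_diff_right bracket_scale_right)
          then show ?thesis using 1 2 subspace_add[OF U(1)] by simp
        qed
        moreover have "bracket z u \<in> W" using u W(2) zB less.prems(3) unfolding W'_def by blast
        ultimately show ?thesis unfolding W'_def by blast
      qed
      obtain w c where w: "w \<in> W' - U" "bracket z w - scale c w \<in> U"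
        using eigenvector_mod_subspace[OF fd U(1) W'sub inv UW'] by blast
      have "\<exists>a. bracket y w - scale a w \<in> U" if "y \<in> span B" for y
      proof -
        have "y \<in> span (insert z ?D)" using that spanC z by (simp add: insert_absorb)
        then obtain k where k: "y - scale k z \<in> span ?D" using span_breakdown_eq by blast
        then have "bracket (y - scale k z) w - scale (\<mu> (y - scale k z)) w \<in> U"
          using w unfolding W'_def by blast
        moreover have "scale k (bracket z w - scale c w) \<in> U" using w U by (simp add: subspace_scale)
        ultimately have "bracket (y - scale k z) w - scale (\<mu> (y - scale k z)) w + scale k (bracket z w - scale c w) \<in> U"
          using subspace_add[OF U(1)] by blast
        then have "bracket y w - scale (\<mu> (y - scale k z) + k * c) w \<in> U"
          by (simp add: bracket_diff_left bracket_scale_left scale_left_distrib scale_right_diff_distrib algebra_simps)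
        then show ?thesis by blast
      qed
      then have "\<exists>\<mu>. \<forall>y\<in>span B. bracket y w - scale (\<mu> y) w \<in> U" by metis
      then show ?thesis using w unfolding W'_def by blast
    qed
  qed
  note claim = this
  obtain A where A: "finite A" "span A = UNIV" using fd by (auto simp: finite_dimensional_def)
  obtain B where B: "B \<subseteq> g" "independent B" "g \<subseteq> span B"
    by (rule maximal_independent_subset)
  then have "span B = g" using g(1) by (simp add: span_minimal subset_antisym)
  moreover have "finite B" using independent_span_bound[OF A(1) B(2)] A(2) by auto
  ultimately show ?thesis using claim[of B] B g by auto
qed

text \<open>Equivalently, every initial segment of the list spans an ideal.\<close>

definition ad_flag :: "'s list \<Rightarrow> bool" where
  "ad_flag ws \<longleftrightarrow> (\<forall>i<length ws. \<forall>y. bracket y (ws ! i) \<in> span (set (take (Suc i) ws)))"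

lemma span_take_mono: "i \<le> j \<Longrightarrow> span (set (take i ws)) \<subseteq> span (set (take j ws))"
  by (intro span_mono set_take_subset_set_take)

lemma ad_flag_invariant:
  assumes "ad_flag ws" "v \<in> span (set (take k ws))"
  shows "bracket y v \<in> span (set (take k ws))"
proof -
  have "span (set (take k ws)) \<subseteq> {v. bracket y v - scale 0 v \<in> span (set (take k ws))}"
  proof (rule span_minimal)
    have "bracket y v \<in> span (set (take k ws))" if v: "v \<in> set (take k ws)" for v
    proof -
      from v obtain i where i: "i < length ws" "i < k" "v = ws ! i"
        by (auto simp: in_set_conv_nth)
      then have "bracket y v \<in> span (set (take (Suc i) ws))" using assms(1) by (auto simp: ad_flag_def)
      then show ?thesis using span_take_mono[of "Suc i" k ws] i by auto
    qed
    then show "set (take k ws) \<subseteq> {v. bracket y v - scale 0 v \<in> span (set (take k ws))}" by auto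
  qed (intro subspace_bracket_preimage subspace_span)
  then show ?thesis using assms(2) by auto
qed

lemma nth_notin_span_take:
  assumes "distinct ws" "independent (set ws)" "i < length ws"
  shows "ws ! i \<notin> span (set (take i ws))"
proof
  assume *: "ws ! i \<in> span (set (take i ws))"
  have "ws ! i \<notin> set (take i ws)"
    using assms(1,3) by (auto simp: in_set_conv_nth nth_eq_iff_index_eq)
  then have "set (take i ws) \<subseteq> set ws - {ws ! i}" using set_take_subset[of i ws] by blast
  with * have "ws ! i \<in> span (set ws - {ws ! i})" using span_mono by blast
  then show False using assms(2,3) unfolding dependent_def by auto
qed

text \<open>A flag of maximal length inside \<open>W\<close> spans \<open>W\<close>, as otherwise a weight vector modulo its span would
  extend it.\<close>

theorem exists_ad_flag_basis:
  assumes fd: "finite_dimensional" and solv: "solvable" and W: "lie_ideal W"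
  obtains ws where "ordered_basis W ws" "ad_flag ws"
proof -
  let ?P = "\<lambda>ws. distinct ws \<and> independent (set ws) \<and> set ws \<subseteq> W \<and> ad_flag ws"
  obtain A where A: "finite A" "span A = UNIV" using fd by (auto simp: finite_dimensional_def)
  have "?P []" by (simp add: ad_flag_def independent_empty)
  moreover have "length ws < Suc (card A)" if "?P ws" for ws
    using that independent_span_bound[OF A(1), of "set ws"] A(2) by (simp add: distinct_card)
  ultimately obtain ws where ws: "?P ws" and max: "\<And>vs. ?P vs \<Longrightarrow> length vs \<le> length ws"
    using ex_has_greatest_nat[of ?P "[]" length "Suc (card A)"] by blast
  have Wsub: "subspace W" using W by (simp add: lie_ideal_def)
  then have "span (set ws) \<subseteq> W" using ws by (simp add: span_minimal)
  moreover have "\<not> span (set ws) \<subset> W"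
  proof
    assume *: "span (set ws) \<subset> W"
    have "bracket y u \<in> span (set ws)" if "u \<in> span (set ws)" for y u
      using ad_flag_invariant[of ws u "length ws" y] ws that by simp
    then obtain w \<mu> where w: "w \<in> W" "w \<notin> span (set ws)" "\<And>y. bracket y w - scale (\<mu> y) w \<in> span (set ws)"
      using exists_weight_vector_mod_subspace[OF fd solv, of UNIV "span (set ws)" W] W Wsub *
      by (auto simp: lie_ideal_def)
    have "bracket y ((ws @ [w]) ! i) \<in> span (set (take (Suc i) (ws @ [w])))" if "i < length (ws @ [w])" for i y
    proof (cases "i < length ws")
      case True
      then show ?thesis using ws by (simp add: nth_append ad_flag_def)
    next
      case False
      then have i: "i = length ws" using that by simp
      have "bracket y w \<in> span (insert w (set ws))"
        using w(3)[of y] by (auto simp: span_breakdown_eq)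
      then show ?thesis using i by simp
    qed
    then have "?P (ws @ [w])"
      using ws w span_base[of w "set ws"] independent_insertI[OF w(2)] by (auto simp: ad_flag_def)
    then show False using max by fastforce
  qed
  ultimately have "span (set ws) = W" by blast
  with ws have "ordered_basis W ws" "ad_flag ws" by (auto simp: ordered_basis_def)
  then show thesis by (rule that)
qed

section \<open>The nilradical\<close>

text \<open>For \<open>x\<close> in a nilpotent ideal, \<open>ad x\<close> maps everything into the ideal and then down its lower central
  series, so it is nilpotent and has no nonzero eigenvalue, not even modulo an invariant subspace.\<close>

lemma nilpotent_ideal_eigenvalue_0:
  assumes J: "nilpotent_ideal J" "x \<in> J"
    and F: "subspace F" "\<And>u. u \<in> F \<Longrightarrow> bracket x u \<in> F"
    and w: "w \<notin> F" "bracket x w - scale c w \<in> F"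
  shows "c = 0"
proof -
  obtain n where n: "lower_central_series J n = {0}" using J(1) by (auto simp: nilpotent_ideal_def)
  have ideal: "subspace J" "\<And>y v. v \<in> J \<Longrightarrow> bracket y v \<in> J"
    using J(1) by (auto simp: nilpotent_ideal_def lie_ideal_def)
  have "(bracket x ^^ Suc k) w \<in> lower_central_series J k" for k
  proof (induction k)
    case 0
    have "- bracket w x \<in> J" using ideal J(2) by (simp add: subspace_neg)
    then show ?case using bracket_antisym[of x w] by simp
  next
    case (Suc k)
    then show ?case using J(2) unfolding lower_central_series.simps bracket_span_def
      by (auto intro!: span_base)
  qed
  from this[of n] n have zero: "(bracket x ^^ Suc n) w = 0" by simp
  have "(bracket x ^^ k) w - scale (c ^ k) w \<in> F" for k
  proof (induction k)
    case 0
    then show ?case using F(1) by (simp add: subspace_0)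
  next
    case (Suc k)
    have "bracket x ((bracket x ^^ k) w - scale (c ^ k) w) \<in> F" by (rule F(2)[OF Suc])
    moreover have "scale (c ^ k) (bracket x w - scale c w) \<in> F" by (rule subspace_scale[OF F(1) w(2)])
    ultimately have "bracket x ((bracket x ^^ k) w - scale (c ^ k) w) + scale (c ^ k) (bracket x w - scale c w) \<in> F"
      by (rule subspace_add[OF F(1)])
    then show ?case
      by (simp add: bracket_diff_right bracket_scale_right scale_right_diff_distrib mult.commute)
  qed
  from this[of "Suc n"] have "- scale (c ^ Suc n) w \<in> F" unfolding zero by simp
  then have *: "scale (c ^ Suc n) w \<in> F" using subspace_neg[OF F(1)] by fastforce
  show ?thesis
  proof (rule ccontr)
    assume "c \<noteq> 0"
    with subspace_scale[OF F(1) *, of "1 / c ^ Suc n"] w(1) show False by simp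
  qed
qed

lemma ad_flag_eigenvalue:
  assumes "ad_flag ws" "i < length ws"
  obtains c where "bracket y (ws ! i) - scale c (ws ! i) \<in> span (set (take i ws))"
proof -
  have "bracket y (ws ! i) \<in> span (insert (ws ! i) (set (take i ws)))"
    using assms by (simp add: ad_flag_def take_Suc_conv_app_nth)
  then show thesis using that by (auto simp: span_breakdown_eq)
qed

text \<open>With respect to a flag of the whole algebra, let \<open>N\<close> consist of the elements that act strictly
  triangularly. Commutators of triangular matrices are strictly triangular, so \<open>N\<close> is an ideal containing
  all commutators; its lower central series descends along the flag. Conversely, elements of nilpotent
  ideals act strictly triangularly. So \<open>N\<close> is the largest nilpotent ideal.\<close>

lemma nilradical_solvable:
  assumes fd: "finite_dimensional" and solv: "solvable"
  shows nilpotent_ideal_nilradical: "nilpotent_ideal nilradical"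
    and bracket_in_nilradical: "bracket x y \<in> nilradical"
proof -
  have "lie_ideal UNIV" by (simp add: lie_ideal_def)
  then obtain ws where "ordered_basis UNIV ws" and flag: "ad_flag ws"
    using exists_ad_flag_basis[OF fd solv] by blast
  then have ws: "distinct ws" "independent (set ws)" "span (set ws) = UNIV"
    by (auto simp: ordered_basis_def)
  define F where "F i = span (set (take i ws))" for i
  define N where "N = {x. \<forall>i<length ws. bracket x (ws ! i) \<in> F i}"
  have subF: "subspace (F i)" for i by (simp add: F_def)
  have inv: "bracket y v \<in> F i" if "v \<in> F i" for y v i
    using ad_flag_invariant[OF flag] that by (simp add: F_def)
  have comm: "bracket x y \<in> N" for x y
    unfolding N_def
  proof (intro CollectI allI impI)
    fix i assume i: "i < length ws"
    obtain a where a: "bracket x (ws ! i) - scale a (ws ! i) \<in> F i"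
      unfolding F_def by (rule ad_flag_eigenvalue[OF flag i])
    obtain b where b: "bracket y (ws ! i) - scale b (ws ! i) \<in> F i"
      unfolding F_def by (rule ad_flag_eigenvalue[OF flag i])
    have "bracket (bracket x y) (ws ! i) =
        bracket x (bracket y (ws ! i) - scale b (ws ! i)) + scale b (bracket x (ws ! i) - scale a (ws ! i))
        - (bracket y (bracket x (ws ! i) - scale a (ws ! i)) + scale a (bracket y (ws ! i) - scale b (ws ! i)))"
      using bracket_derivation[of x y "ws ! i"]
      by (simp add: bracket_diff_right bracket_scale_right scale_right_diff_distrib mult.commute)
    also have "\<dots> \<in> F i"
      by (rule subspace_diff[OF subF subspace_add[OF subF inv[OF b] subspace_scale[OF subF a]]
          subspace_add[OF subF inv[OF a] subspace_scale[OF subF b]]])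
    finally show "bracket (bracket x y) (ws ! i) \<in> F i" .
  qed
  have "subspace N"
    by (rule subspaceI)
      (auto simp: N_def bracket_add_left bracket_scale_left subspace_0[OF subF] subspace_add[OF subF] subspace_scale[OF subF])
  then have "lie_ideal N" using comm by (simp add: lie_ideal_def)
  have lower: "bracket x v \<in> F (i - 1)" if "x \<in> N" "v \<in> F i" for x v i
  proof -
    have "F i \<subseteq> {v. bracket x v - scale 0 v \<in> F (i - 1)}"
      unfolding F_def[of i]
    proof (rule span_minimal)
      have "bracket x v \<in> F (i - 1)" if v: "v \<in> set (take i ws)" for v
      proof -
        from v obtain j where j: "j < length ws" "j < i" "v = ws ! j" by (auto simp: in_set_conv_nth)
        then have "bracket x v \<in> F j" using \<open>x \<in> N\<close> by (simp add: N_def)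
        moreover have "F j \<subseteq> F (i - 1)"
          unfolding F_def by (rule span_take_mono) (use j in simp)
        ultimately show ?thesis by blast
      qed
      then show "set (take i ws) \<subseteq> {v. bracket x v - scale 0 v \<in> F (i - 1)}" by auto
    qed (intro subspace_bracket_preimage subF)
    then show ?thesis using that(2) by auto
  qed
  have "lower_central_series N k \<subseteq> F (length ws - k)" for k
  proof (induction k)
    case 0
    then show ?case using ws(3) by (simp add: F_def)
  next
    case (Suc k)
    have "{bracket x v |x v. x \<in> N \<and> v \<in> lower_central_series N k} \<subseteq> F (length ws - Suc k)"
      using lower[of _ _ "length ws - k"] Suc by auto
    then show ?case
      unfolding lower_central_series.simps bracket_span_def by (rule span_minimal[OF _ subF])
  qed
  from this[of "length ws"] have "lower_central_series N (length ws) \<subseteq> {0}" by (simp add: F_def)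
  moreover have "0 \<in> lower_central_series N k" for k
    using \<open>subspace N\<close> by (cases k) (auto simp: bracket_span_def subspace_0 span_zero)
  ultimately have nilp: "nilpotent_ideal N"
    using \<open>lie_ideal N\<close> unfolding nilpotent_ideal_def by blast
  have sub: "J \<subseteq> N" if J: "nilpotent_ideal J" for J
  proof
    fix x assume "x \<in> J"
    have "bracket x (ws ! i) \<in> F i" if i: "i < length ws" for i
    proof -
      obtain c where c: "bracket x (ws ! i) - scale c (ws ! i) \<in> F i"
        unfolding F_def by (rule ad_flag_eigenvalue[OF flag i])
      have "ws ! i \<notin> F i" unfolding F_def by (rule nth_notin_span_take[OF ws(1,2) i])
      then have "c = 0"
        using nilpotent_ideal_eigenvalue_0[OF J \<open>x \<in> J\<close> subF inv _ c] by blast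
      then show ?thesis using c by simp
    qed
    then show "x \<in> N" by (simp add: N_def)
  qed
  have "nilradical = N"
    unfolding nilradical_def
  proof (rule the_equality)
    show "maximal_nilpotent_ideal N"
      using nilp sub unfolding maximal_nilpotent_ideal_def by blast
    show "I = N" if "maximal_nilpotent_ideal I" for I
      using that nilp sub unfolding maximal_nilpotent_ideal_def by blast
  qed
  then show "nilpotent_ideal nilradical" "bracket x y \<in> nilradical" using nilp comm by simp_all
qed

section \<open>Coordinates and triangular adjoint matrices\<close>

lemma ordered_basis_expansion:
  assumes "ordered_basis U bs" "v \<in> U"
  shows "v = (\<Sum>k<length bs. scale (representation (set bs) v (bs ! k)) (bs ! k))"
proof -
  have bij: "bij_betw ((!) bs) {..<length bs} (set bs)"
    using assms(1) by (auto simp: ordered_basis_def intro: bij_betw_nth)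
  have "v = (\<Sum>b\<in>set bs. scale (representation (set bs) v b) b)"
    using assms by (intro sum_representation_eq[symmetric]) (auto simp: ordered_basis_def)
  also have "\<dots> = (\<Sum>k<length bs. scale (representation (set bs) v (bs ! k)) (bs ! k))"
    by (rule sum.reindex_bij_betw[OF bij, symmetric])
  finally show ?thesis .
qed

lemma representation_nth:
  assumes "ordered_basis U bs" "i < length bs" "j < length bs"
  shows "representation (set bs) (bs ! j) (bs ! i) = (if i = j then 1 else 0)"
  using assms by (auto simp: ordered_basis_def representation_basis nth_eq_iff_index_eq)

text \<open>The identity and the maps \<open>ad y\<close> are the two cases needed: they give the inverse of a transition
  matrix and the conjugation of adjoint matrices.\<close>

lemma representation_change_of_basis:
  assumes "ordered_basis U bs" "ordered_basis U' cs" "v \<in> U"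
    and f: "f \<in> {id, bracket y}" "\<And>u. u \<in> U \<Longrightarrow> f u \<in> U'"
  shows "representation (set cs) (f v) c =
    (\<Sum>k<length bs. representation (set bs) v (bs ! k) * representation (set cs) (f (bs ! k)) c)"
proof -
  let ?r = "\<lambda>k. representation (set bs) v (bs ! k)"
  have cs: "independent (set cs)" "span (set cs) = U'" using assms(2) by (auto simp: ordered_basis_def)
  have "bs ! k \<in> U" if "k < length bs" for k
    using assms(1) that span_base by (auto simp: ordered_basis_def)
  then have mem: "f (bs ! k) \<in> span (set cs)" if "k < length bs" for k using f(2) cs(2) that by simp
  have "f v = f (\<Sum>k<length bs. scale (?r k) (bs ! k))"
    using ordered_basis_expansion[OF assms(1,3)] by simp
  also have "\<dots> = (\<Sum>k<length bs. scale (?r k) (f (bs ! k)))"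
    using f(1) by (auto simp: bracket_sum_right bracket_scale_right)
  finally have "representation (set cs) (f v) c = representation (set cs) (\<Sum>k<length bs. scale (?r k) (f (bs ! k))) c"
    by simp
  also have "\<dots> = (\<Sum>k<length bs. representation (set cs) (scale (?r k) (f (bs ! k))) c)"
    using mem by (subst representation_sum[OF cs(1)]) (auto intro: span_scale)
  also have "\<dots> = (\<Sum>k<length bs. ?r k * representation (set cs) (f (bs ! k)) c)"
    using mem by (intro sum.cong) (auto simp: representation_scale[OF cs(1)])
  finally show ?thesis .
qed

lemma length_ordered_basis: "ordered_basis U bs \<Longrightarrow> length bs = dim U"
  using dim_span_eq_card_independent[of "set bs"] by (auto simp: ordered_basis_def distinct_card)

lemma ad_matrix_carrier [simp]: "ad_matrix bs y \<in> carrier_mat (length bs) (length bs)"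
  by (simp add: ad_matrix_def)

lemma ad_matrix_index:
  "i < length bs \<Longrightarrow> j < length bs \<Longrightarrow>
    ad_matrix bs y $$ (i, j) = representation (set bs) (bracket y (bs ! j)) (bs ! i)"
  by (simp add: ad_matrix_def)

lemma in_span_take_iff:
  assumes "ordered_basis U ws" "v \<in> U"
  shows "v \<in> span (set (take m ws)) \<longleftrightarrow> (\<forall>i<length ws. m \<le> i \<longrightarrow> representation (set ws) v (ws ! i) = 0)"
proof
  assume *: "v \<in> span (set (take m ws))"
  have ws: "distinct ws" "independent (set ws)" using assms(1) by (auto simp: ordered_basis_def)
  show "\<forall>i<length ws. m \<le> i \<longrightarrow> representation (set ws) v (ws ! i) = 0"
  proof (intro allI impI)
    fix i assume "i < length ws" "m \<le> i"
    then have "ws ! i \<notin> set (take m ws)"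
      using ws(1) by (auto simp: in_set_conv_nth nth_eq_iff_index_eq)
    moreover have "representation (set ws) v = representation (set (take m ws)) v"
      by (rule representation_extend[OF ws(2) * set_take_subset])
    ultimately show "representation (set ws) v (ws ! i) = 0"
      using representation_ne_zero by metis
  qed
next
  assume *: "\<forall>i<length ws. m \<le> i \<longrightarrow> representation (set ws) v (ws ! i) = 0"
  have "(\<Sum>k<length ws. scale (representation (set ws) v (ws ! k)) (ws ! k)) \<in> span (set (take m ws))"
  proof (rule span_sum)
    fix k assume k: "k \<in> {..<length ws}"
    show "scale (representation (set ws) v (ws ! k)) (ws ! k) \<in> span (set (take m ws))"
    proof (cases "m \<le> k")
      case True
      then show ?thesis using * k by (simp add: span_zero)
    next
      case False
      then have "ws ! k \<in> set (take m ws)" using k by (auto simp: in_set_conv_nth)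
      then show ?thesis by (intro span_scale span_base)
    qed
  qed
  then show "v \<in> span (set (take m ws))" using ordered_basis_expansion[OF assms] by simp
qed

lemma upper_triangular_iff_ad_flag:
  assumes "lie_ideal U" "ordered_basis U ws"
  shows "(\<forall>y. upper_triangular (ad_matrix ws y)) \<longleftrightarrow> ad_flag ws"
proof -
  have "ws ! j \<in> U" if "j < length ws" for j
    using assms(2) that span_base by (auto simp: ordered_basis_def)
  then have "bracket y (ws ! j) \<in> U" if "j < length ws" for j y
    using assms(1) that by (simp add: lie_ideal_def)
  note iff = in_span_take_iff[OF assms(2) this]
  have "dim_row (ad_matrix ws y) = length ws" for y by (simp add: ad_matrix_def)
  then show ?thesis
    unfolding upper_triangular_def ad_flag_def
    by (auto simp: iff ad_matrix_index Suc_le_eq)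
qed

lemma ad_flag_diagonal:
  assumes "lie_ideal U" "ordered_basis U ws" "ad_flag ws" "i < length ws"
  shows "bracket y (ws ! i) - scale (ad_matrix ws y $$ (i, i)) (ws ! i) \<in> span (set (take i ws))"
proof -
  have ws: "independent (set ws)" "span (set ws) = U" "distinct ws" using assms(2) by (auto simp: ordered_basis_def)
  obtain c where c: "bracket y (ws ! i) - scale c (ws ! i) \<in> span (set (take i ws))"
    by (rule ad_flag_eigenvalue[OF assms(3,4)])
  have mem: "ws ! i \<in> U" "bracket y (ws ! i) \<in> U"
    using assms(1,2,4) span_base[of "ws ! i" "set ws"] by (auto simp: ordered_basis_def lie_ideal_def)
  have "bracket y (ws ! i) - scale c (ws ! i) \<in> U"
    using c span_mono[OF set_take_subset, of i ws] ws(2) by blast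
  then have "representation (set ws) (bracket y (ws ! i) - scale c (ws ! i)) (ws ! i) = 0"
    using c in_span_take_iff[OF assms(2)] assms(4) by blast
  moreover have "scale c (ws ! i) \<in> U" using assms(1) mem(1) by (simp add: lie_ideal_def subspace_scale)
  ultimately have "ad_matrix ws y $$ (i, i) = c"
    using mem ws(2) assms(4) representation_nth[OF assms(2,4,4)]
    by (simp add: representation_diff[OF ws(1)] representation_scale[OF ws(1)] ad_matrix_index)
  then show ?thesis using c by simp
qed

lemma diagonal_vanishes_on_nilpotent_ideal:
  assumes "nilpotent_ideal U" "ordered_basis U ws" "ad_flag ws" "i < length ws" "x \<in> U"
  shows "ad_matrix ws x $$ (i, i) = 0"
proof (rule nilpotent_ideal_eigenvalue_0[OF assms(1,5)])
  show "ws ! i \<notin> span (set (take i ws))"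
    using assms(2,4) by (intro nth_notin_span_take) (auto simp: ordered_basis_def)
  show "bracket x (ws ! i) - scale (ad_matrix ws x $$ (i, i)) (ws ! i) \<in> span (set (take i ws))"
    using assms by (intro ad_flag_diagonal) (auto simp: nilpotent_ideal_def)
  show "bracket x u \<in> span (set (take i ws))" if "u \<in> span (set (take i ws))" for u
    by (rule ad_flag_invariant[OF assms(3) that])
qed simp

section \<open>Determinants of the adjoint pencil\<close>

text \<open>Here the basis \<open>bs\<close> in which the operators are written and the list \<open>ys\<close> of elements that act are
  independent of each other, so that the same family of operators can be compared in different bases and on an
  ideal.\<close>

definition ad_pencil :: "'s list \<Rightarrow> 's list \<Rightarrow> cpoly mat" where
  "ad_pencil bs ys = mat (length bs) (length bs)
     (\<lambda>(i, j). (if i = j then indet 0 else 0) +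
        (\<Sum>l<length ys. indet (Suc l) * const_poly (ad_matrix bs (ys ! l) $$ (i, j))))"

lemma ad_pencil_carrier [simp]: "ad_pencil bs ys \<in> carrier_mat (length bs) (length bs)"
  by (simp add: ad_pencil_def)

lemma char_polynomial_eq_det_ad_pencil: "char_polynomial bs = det (ad_pencil bs bs)"
  by (simp add: char_polynomial_def ad_pencil_def)

definition transition_mat :: "'s list \<Rightarrow> 's list \<Rightarrow> cpoly mat" where
  "transition_mat bs cs = mat (length cs) (length bs)
     (\<lambda>(i, j). const_poly (representation (set cs) (bs ! j) (cs ! i)))"

text \<open>The transition matrix between the two bases has constant entries, so it conjugates every coefficient of
  the pencil at once.\<close>

lemma det_ad_pencil_change_of_basis:
  assumes U: "lie_ideal U" and bs: "ordered_basis U bs" and cs: "ordered_basis U cs"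
  shows "det (ad_pencil bs ys) = det (ad_pencil cs ys)"
proof -
  define n where "n = length bs"
  have len: "length bs = n" "length cs = n"
    using length_ordered_basis[OF bs] length_ordered_basis[OF cs] by (auto simp: n_def)
  let ?P = "transition_mat bs cs" and ?P' = "transition_mat cs bs"
  have dim: "?P \<in> carrier_mat n n" "?P' \<in> carrier_mat n n"
    "ad_pencil bs ys \<in> carrier_mat n n" "ad_pencil cs ys \<in> carrier_mat n n"
    using len by (auto simp: transition_mat_def ad_pencil_def)
  have mem: "bs ! k \<in> U" "cs ! k \<in> U" if "k < n" for k
    using bs cs that span_base len by (auto simp: ordered_basis_def)
  have inv: "bracket y u \<in> U" if "u \<in> U" for y u using U that by (simp add: lie_ideal_def)
  let ?r = "\<lambda>as v i. representation (set as) v (as ! i)"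
  have "?P * ?P' = 1\<^sub>m n"
  proof (rule eq_matI)
    fix i j assume ij: "i < dim_row (1\<^sub>m n :: cpoly mat)" "j < dim_col (1\<^sub>m n :: cpoly mat)"
    then have "(?P * ?P') $$ (i, j) = (\<Sum>k<n. const_poly (?r cs (bs ! k) i) * const_poly (?r bs (cs ! j) k))"
      using dim len by (auto simp: scalar_prod_def transition_mat_def atLeast0LessThan)
    also have "\<dots> = const_poly (\<Sum>k<n. ?r bs (cs ! j) k * ?r cs (bs ! k) i)"
      by (simp add: const_poly_sum const_poly_mult mult.commute)
    also have "(\<Sum>k<n. ?r bs (cs ! j) k * ?r cs (bs ! k) i) = ?r cs (cs ! j) i"
      using representation_change_of_basis[OF bs cs mem(2), of j id] ij len by simp
    also have "\<dots> = (if i = j then 1 else 0)"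
      using ij len by (intro representation_nth[OF cs]) auto
    finally show "(?P * ?P') $$ (i, j) = 1\<^sub>m n $$ (i, j)" using ij by simp
  qed (use dim in auto)
  then have "det ?P * det ?P' = 1"
    using det_mult[OF dim(1,2)] by simp
  then have nz: "det ?P \<noteq> 0" by auto
  have "?P * ad_pencil bs ys = ad_pencil cs ys * ?P"
  proof (rule eq_matI)
    fix i j assume "i < dim_row (ad_pencil cs ys * ?P)" "j < dim_col (ad_pencil cs ys * ?P)"
    then have ij: "i < n" "j < n" using dim by auto
    let ?p = "\<lambda>k j. const_poly (?r cs (bs ! j) k)"
    let ?z = "\<lambda>l. indet (Suc l)"
    let ?L = "length ys"
    \<comment> \<open>Both sides are the \<open>i\<close>th coordinate in \<open>cs\<close> of \<open>bracket y (bs ! j)\<close>.\<close>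
    have key: "(\<Sum>k<n. ?r cs (bs ! k) i * ad_matrix bs y $$ (k, j)) =
        (\<Sum>k<n. ad_matrix cs y $$ (i, k) * ?r cs (bs ! j) k)" for y
    proof -
      have "(\<Sum>k<n. ?r cs (bs ! k) i * ad_matrix bs y $$ (k, j)) = ?r cs (bracket y (bs ! j)) i"
        using representation_change_of_basis[OF bs cs inv[OF mem(1)], of j id y] ij len
        by (simp add: ad_matrix_index mult.commute)
      also have "\<dots> = (\<Sum>k<n. ad_matrix cs y $$ (i, k) * ?r cs (bs ! j) k)"
        using representation_change_of_basis[OF cs cs mem(1), of j "bracket y" y] ij len inv
        by (simp add: ad_matrix_index mult.commute)
      finally show ?thesis .
    qed
    have swap: "(\<Sum>k<n. \<Sum>l<?L. ?z l * const_poly (g k l)) = (\<Sum>l<?L. ?z l * const_poly (\<Sum>k<n. g k l))"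
      for g by (subst sum.swap) (simp add: const_poly_sum sum_distrib_left)
    have "(?P * ad_pencil bs ys) $$ (i, j) = (\<Sum>k<n. ?p i k * ((if k = j then indet 0 else 0) +
        (\<Sum>l<?L. ?z l * const_poly (ad_matrix bs (ys ! l) $$ (k, j)))))"
      using dim len ij by (auto simp: scalar_prod_def transition_mat_def ad_pencil_def atLeast0LessThan intro!: sum.cong)
    also have "\<dots> = (\<Sum>k<n. if k = j then ?p i k * indet 0 else 0) +
        (\<Sum>k<n. \<Sum>l<?L. ?z l * const_poly (?r cs (bs ! k) i * ad_matrix bs (ys ! l) $$ (k, j)))"
      unfolding sum.distrib[symmetric]
      by (intro sum.cong refl) (auto simp: distrib_left sum_distrib_left const_poly_mult mult_ac)
    also have "\<dots> = ?p i j * indet 0 +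
        (\<Sum>l<?L. ?z l * const_poly (\<Sum>k<n. ?r cs (bs ! k) i * ad_matrix bs (ys ! l) $$ (k, j)))"
      unfolding swap using ij by simp
    also have "\<dots> = indet 0 * ?p i j +
        (\<Sum>l<?L. ?z l * const_poly (\<Sum>k<n. ad_matrix cs (ys ! l) $$ (i, k) * ?r cs (bs ! j) k))"
      by (simp only: key mult.commute)
    also have "\<dots> = (\<Sum>k<n. if i = k then indet 0 * ?p k j else 0) +
        (\<Sum>k<n. \<Sum>l<?L. ?z l * const_poly (ad_matrix cs (ys ! l) $$ (i, k) * ?r cs (bs ! j) k))"
      unfolding swap using ij by simp
    also have "\<dots> = (\<Sum>k<n. ((if i = k then indet 0 else 0) +
        (\<Sum>l<?L. ?z l * const_poly (ad_matrix cs (ys ! l) $$ (i, k)))) * ?p k j)"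
      unfolding sum.distrib[symmetric]
      by (intro sum.cong refl) (auto simp: distrib_left sum_distrib_left const_poly_mult mult_ac)
    also have "\<dots> = (ad_pencil cs ys * ?P) $$ (i, j)"
      using dim len ij by (auto simp: scalar_prod_def transition_mat_def ad_pencil_def atLeast0LessThan intro!: sum.cong)
    finally show "(?P * ad_pencil bs ys) $$ (i, j) = (ad_pencil cs ys * ?P) $$ (i, j)" .
  qed (use dim in auto)
  then have "det ?P * det (ad_pencil bs ys) = det ?P * det (ad_pencil cs ys)"
    by (metis det_mult[OF dim(1,3)] det_mult[OF dim(4,1)] mult.commute)
  then show ?thesis using nz by simp
qed

lemma sum_lessThan_add:
  fixes f :: "nat \<Rightarrow> 'b::comm_monoid_add"
  shows "(\<Sum>l<m + n. f l) = (\<Sum>l<m. f l) + (\<Sum>j<n. f (m + j))"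
  by (induction n) (simp_all add: add.assoc)

lemma independent_complement_append:
  assumes bs: "ordered_basis U bs" and cs: "ordered_basis V cs" and UV: "complement_of U V"
  shows "independent (set (bs @ cs))"
proof -
  have "independent (set bs \<union> C)" if "C \<subseteq> set cs" for C
    using finite_subset[OF that finite_set] that
  proof (induction C rule: finite_induct)
    case empty
    then show ?case using bs by (simp add: ordered_basis_def)
  next
    case (insert c C)
    have "c \<notin> span (set bs \<union> C)"
    proof
      assume "c \<in> span (set bs \<union> C)"
      then obtain a b where ab: "c = a + b" "a \<in> span (set bs)" "b \<in> span C"
        unfolding span_Un by blast
      have "span C \<subseteq> V" using insert.prems cs span_mono[of C "set cs"] by (auto simp: ordered_basis_def)
      moreover have "c \<in> V" using insert.prems cs span_base[of c "set cs"] by (auto simp: ordered_basis_def)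
      ultimately have "c - b \<in> V" using UV ab(3) by (auto simp: complement_of_def intro!: subspace_diff)
      then have "a \<in> U \<inter> V" using ab bs by (auto simp: ordered_basis_def)
      then have "a = 0" using UV by (auto simp: complement_of_def)
      then have "c \<in> span C" using ab by simp
      moreover have "C \<subseteq> set cs - {c}" using insert by auto
      ultimately have "c \<in> span (set cs - {c})" using span_mono by blast
      then show False using cs insert.prems unfolding ordered_basis_def dependent_def by auto
    qed
    then show ?case using insert by (simp add: independent_insertI)
  qed
  then show ?thesis by simp
qed

text \<open>Brackets have no component along the complement, so the lower rows of the pencil vanish apart from
  \<open>indet 0\<close> on the diagonal.\<close>

lemma det_ad_pencil_block:
  assumes U: "ordered_basis U bs" "\<And>x y. bracket x y \<in> U"
    and V: "ordered_basis V cs" and UV: "complement_of U V"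
  shows "det (ad_pencil (bs @ cs) ys) = indet 0 ^ length cs * det (ad_pencil bs ys)"
proof -
  let ?n = "length bs" and ?k = "length cs" and ?A = "ad_pencil (bs @ cs) ys"
  note ind = independent_complement_append[OF U(1) V UV]
  have "representation (set (bs @ cs)) (bracket x y) = representation (set bs) (bracket x y)" for x y
    by (rule representation_extend[OF ind]) (use U in \<open>auto simp: ordered_basis_def\<close>)
  note rep = this[unfolded set_append]
  have disj: "cs ! i \<notin> set bs" if "i < ?k" for i
  proof
    assume "cs ! i \<in> set bs"
    then have "cs ! i \<in> U \<inter> V" using U V that span_base by (auto simp: ordered_basis_def)
    then have "cs ! i = 0" using UV by (auto simp: complement_of_def)
    then show False using V that dependent_zero nth_mem[of i cs] by (auto simp: ordered_basis_def)
  qed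
  have upper: "ad_matrix (bs @ cs) y $$ (i, j) = ad_matrix bs y $$ (i, j)" if "i < ?n" "j < ?n" for i j y
    using that by (simp add: ad_matrix_index rep nth_append)
  have lower: "ad_matrix (bs @ cs) y $$ (i, j) = 0" if "?n \<le> i" "i < ?n + ?k" "j < ?n + ?k" for i j y
  proof -
    have "representation (set bs) v (cs ! (i - ?n)) = 0" for v
      using disj[of "i - ?n"] representation_ne_zero[of "set bs" v] that by fastforce
    then show ?thesis using that by (simp add: ad_matrix_index rep nth_append)
  qed
  let ?B = "mat ?n ?k (\<lambda>(i, j). ?A $$ (i, ?n + j))"
  have "?A = four_block_mat (ad_pencil bs ys) ?B (0\<^sub>m ?k ?n) (indet 0 \<cdot>\<^sub>m 1\<^sub>m ?k)"
  proof (rule eq_matI)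
    fix i j
    assume "i < dim_row (four_block_mat (ad_pencil bs ys) ?B (0\<^sub>m ?k ?n) (indet 0 \<cdot>\<^sub>m 1\<^sub>m ?k))"
      "j < dim_col (four_block_mat (ad_pencil bs ys) ?B (0\<^sub>m ?k ?n) (indet 0 \<cdot>\<^sub>m 1\<^sub>m ?k))"
    then have ij: "i < ?n + ?k" "j < ?n + ?k" by (auto simp: ad_pencil_def)
    show "?A $$ (i, j) = four_block_mat (ad_pencil bs ys) ?B (0\<^sub>m ?k ?n) (indet 0 \<cdot>\<^sub>m 1\<^sub>m ?k) $$ (i, j)"
      using ij upper lower by (auto simp: ad_pencil_def)
  qed (auto simp: ad_pencil_def)
  then have "det ?A = det (ad_pencil bs ys) * det (indet 0 \<cdot>\<^sub>m 1\<^sub>m ?k)"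
    using det_four_block_mat_lower_left_zero[of "ad_pencil bs ys" ?n ?B ?k "0\<^sub>m ?k ?n" "indet 0 \<cdot>\<^sub>m 1\<^sub>m ?k"]
    by simp
  then show ?thesis by simp
qed

text \<open>The diagonal functionals vanish on the nilpotent ideal, hence only the indeterminates attached to
  \<open>fs\<close> survive on the diagonal.\<close>

lemma det_ad_pencil_triangular:
  assumes N: "nilpotent_ideal N" and ws: "ordered_basis N ws" "ad_flag ws"
    and xs: "set xs \<subseteq> N" and fs: "set fs \<subseteq> V"
  shows "det (ad_pencil ws (xs @ fs)) =
    prod_mset (image_mset (monic_weight_form xs fs) (diagonal_functionals V ws))"
proof -
  let ?n = "length ws"
  have ideal: "lie_ideal N" using N by (simp add: nilpotent_ideal_def)
  have ut: "upper_triangular (ad_matrix ws y)" for y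
    using upper_triangular_iff_ad_flag[OF ideal ws(1)] ws(2) by blast
  have "ad_matrix ws y $$ (i, j) = 0" if "i < ?n" "j < i" for y i j
    using ut[of y] that by (auto simp: upper_triangular_def ad_matrix_def)
  then have "upper_triangular (ad_pencil ws (xs @ fs))"
    unfolding upper_triangular_def by (auto simp: ad_pencil_def)
  then have "det (ad_pencil ws (xs @ fs)) = prod_list (diag_mat (ad_pencil ws (xs @ fs)))"
    by (rule det_upper_triangular[OF _ ad_pencil_carrier])
  also have "diag_mat (ad_pencil ws (xs @ fs)) = map (\<lambda>i. ad_pencil ws (xs @ fs) $$ (i, i)) [0..<?n]"
    by (simp add: diag_mat_def ad_pencil_def)
  also have "\<dots> = map (monic_weight_form xs fs \<circ> (\<lambda>i. restrict (\<lambda>y. ad_matrix ws y $$ (i, i)) V)) [0..<?n]"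
  proof (rule map_cong[OF refl])
    fix i assume "i \<in> set [0..<?n]"
    then have i: "i < ?n" by simp
    have "ad_matrix ws (xs ! l) $$ (i, i) = 0" if "l < length xs" for l
      using xs that by (intro diagonal_vanishes_on_nilpotent_ideal[OF N ws i]) auto
    moreover have "fs ! j \<in> V" if "j < length fs" for j using fs that by auto
    ultimately show "ad_pencil ws (xs @ fs) $$ (i, i) =
        (monic_weight_form xs fs \<circ> (\<lambda>i. restrict (\<lambda>y. ad_matrix ws y $$ (i, i)) V)) i"
      using i by (simp add: ad_pencil_def monic_weight_form_def weight_form_def sum_lessThan_add
          nth_append mult.commute)
  qed
  also have "prod_list \<dots> = prod_mset (image_mset (monic_weight_form xs fs) (diagonal_functionals V ws))"
    by (simp add: diagonal_functionals_def prod_mset_prod_list[symmetric] mset_map[symmetric] comp_def del: mset_map)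
  finally show ?thesis .
qed

section \<open>Nilradical weights and the characteristic polynomial\<close>

text \<open>The linear functionals on \<open>V\<close>, in the encoding as functions that are undefined outside \<open>V\<close>.\<close>

definition dual_element :: "'s set \<Rightarrow> ('s \<Rightarrow> complex) \<Rightarrow> bool" where
  "dual_element V \<alpha> \<longleftrightarrow> \<alpha> \<in> extensional V \<and>
     (\<forall>x\<in>V. \<forall>y\<in>V. \<alpha> (x + y) = \<alpha> x + \<alpha> y) \<and> (\<forall>c. \<forall>x\<in>V. \<alpha> (scale c x) = c * \<alpha> x)"

lemma dual_element_eqI:
  assumes "dual_element V \<alpha>" "dual_element V \<beta>" and V: "ordered_basis V fs"
    and eq: "\<And>j. j < length fs \<Longrightarrow> \<alpha> (fs ! j) = \<beta> (fs ! j)"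
  shows "\<alpha> = \<beta>"
proof (rule extensionalityI[of _ V])
  have subV: "subspace V" "V = span (set fs)" using V by (auto simp: ordered_basis_def)
  have "V \<subseteq> {v \<in> V. \<alpha> v = \<beta> v}"
    unfolding subV(2)
  proof (rule span_minimal)
    show "set fs \<subseteq> {v \<in> span (set fs). \<alpha> v = \<beta> v}"
      using eq by (auto simp: in_set_conv_nth intro: span_base)
    have "\<alpha> 0 = 0" "\<beta> 0 = 0"
      using assms(1,2) subspace_0[OF subV(1)] unfolding dual_element_def
      by (metis mult_zero_left scale_zero_left)+
    then have "subspace {v \<in> V. \<alpha> v = \<beta> v}"
      using assms(1,2) subV(1)
      by (intro subspaceI) (auto simp: dual_element_def subspace_0 subspace_add subspace_scale)
    then show "subspace {v \<in> span (set fs). \<alpha> v = \<beta> v}" by (simp add: subV(2))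
  qed
  then show "\<alpha> v = \<beta> v" if "v \<in> V" for v using that by blast
qed (use assms in \<open>auto simp: dual_element_def\<close>)

text \<open>The coefficient of \<open>z\<^sub>0\<close> forces \<open>c = 1\<close>; the other coefficients are the values of the functional
  on the basis \<open>fs\<close>.\<close>

lemma monic_weight_form_multiple_eq:
  assumes "dual_element V \<alpha>" "dual_element V \<beta>" and V: "ordered_basis V fs"
    and eq: "monic_weight_form xs fs \<alpha> = const_poly c * monic_weight_form xs fs \<beta>"
  shows "\<alpha> = \<beta>"
proof (rule dual_element_eqI[OF assms(1-3)])
  have "c = 1"
    using arg_cong[OF eq, of "\<lambda>p. Poly_Mapping.lookup p (Poly_Mapping.single 0 (Suc 0))"]
    by (simp add: lookup_monic_weight_form)
  then show "\<alpha> (fs ! j) = \<beta> (fs ! j)" if "j < length fs" for j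
    using arg_cong[OF eq, of "\<lambda>p. Poly_Mapping.lookup p (Poly_Mapping.single (Suc (length xs + j)) (Suc 0))"] that
    by (simp add: lookup_monic_weight_form)
qed

lemma dual_element_diagonal_functionals:
  assumes U: "lie_ideal U" "ordered_basis U ws" and V: "subspace V" and "\<alpha> \<in># diagonal_functionals V ws"
  shows "dual_element V \<alpha>"
proof -
  obtain i where i: "i < length ws" "\<alpha> = restrict (\<lambda>y. ad_matrix ws y $$ (i, i)) V"
    using assms(4) by (auto simp: diagonal_functionals_def)
  have ws: "independent (set ws)" "span (set ws) = U" using U(2) by (auto simp: ordered_basis_def)
  then have "bracket y (ws ! i) \<in> U" for y
    using U(1) i(1) span_base[of "ws ! i" "set ws"] by (auto simp: lie_ideal_def)
  then show ?thesis
    using i V ws unfolding dual_element_def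
    by (auto simp: ad_matrix_index bracket_add_left bracket_scale_left subspace_add subspace_scale
        representation_add[OF ws(1)] representation_scale[OF ws(1)])
qed

text \<open>Two triangularizing bases give the same determinant, written as two products of linear forms. Unique
  factorization recovers the multiset of functionals. The pencil is formed with \<open>fs\<close>
  alone, since the action of a basis of \<open>V\<close> determines the functionals on \<open>V\<close>.\<close>

lemma nilradical_weights_eq:
  assumes fd: "finite_dimensional" and solv: "solvable"
    and V: "ordered_basis V fs" and ws: "triangularizing_basis ws"
  shows "nilradical_weights V = diagonal_functionals V ws"
  unfolding nilradical_weights_def
proof (rule the_equality)
  show "\<exists>vs. triangularizing_basis vs \<and> diagonal_functionals V ws = diagonal_functionals V vs"
    using ws by blast
next
  note nilp = nilpotent_ideal_nilradical[OF fd solv]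
  then have ideal: "lie_ideal nilradical" by (simp add: nilpotent_ideal_def)
  have flag: "ordered_basis nilradical vs" "ad_flag vs" if "triangularizing_basis vs" for vs
    using that upper_triangular_iff_ad_flag[OF ideal] by (auto simp: triangularizing_basis_def)
  have subV: "subspace V" using V by (auto simp: ordered_basis_def)
  fix W assume "\<exists>vs. triangularizing_basis vs \<and> W = diagonal_functionals V vs"
  then obtain vs where vs: "triangularizing_basis vs" and W: "W = diagonal_functionals V vs" by blast
  let ?L = "monic_weight_form [] fs"
  have prod: "det (ad_pencil us fs) = prod_mset (image_mset ?L (diagonal_functionals V us))"
    if "triangularizing_basis us" for us
    using det_ad_pencil_triangular[OF nilp flag[OF that], of "[]" fs V] V span_superset[of "set fs"]
    by (simp add: ordered_basis_def)
  have dual: "dual_element V \<alpha>" if "\<alpha> \<in># W + diagonal_functionals V ws" for \<alpha>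
    using that dual_element_diagonal_functionals[OF ideal _ subV] flag(1)[OF ws] flag(1)[OF vs]
    by (auto simp: W)
  show "W = diagonal_functionals V ws"
  proof (rule prod_primes_unique[of ?L])
    show "prod_mset (image_mset ?L W) = prod_mset (image_mset ?L (diagonal_functionals V ws))"
      using prod[OF ws] prod[OF vs] det_ad_pencil_change_of_basis[OF ideal flag(1)[OF vs] flag(1)[OF ws]]
      by (simp add: W)
    show "\<alpha> = \<beta>" if "\<alpha> \<in># W + diagonal_functionals V ws" "\<beta> \<in># W + diagonal_functionals V ws"
      "?L \<alpha> = const_poly c * ?L \<beta>" for \<alpha> \<beta> c
      by (rule monic_weight_form_multiple_eq[OF dual[OF that(1)] dual[OF that(2)] V that(3)])
  qed (rule prime_elem_monic_weight_form)
qed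

theorem char_polynomial_and_spectral_index:
  assumes fd: "finite_dimensional" and solv: "solvable" and nontrivial: "(UNIV :: 's set) \<noteq> {0}"
    and V: "complement_of nilradical V"
    and xs: "ordered_basis nilradical xs" and fs: "ordered_basis V fs"
  shows "char_polynomial (xs @ fs) = indet 0 ^ dim V *
      (\<Prod>\<alpha>\<in>set_mset (nilradical_weights V).
        (indet 0 + weight_form xs fs \<alpha>) ^ count (nilradical_weights V) \<alpha>)"
    and "spectral_index (xs @ fs) = card (set_mset (nilradical_weights V) \<union> {restrict (\<lambda>_. 0) V})"
proof -
  let ?L = "monic_weight_form xs fs" and ?W = "nilradical_weights V"
  let ?zero = "restrict (\<lambda>_. 0) V :: 's \<Rightarrow> complex"
  note nilp = nilpotent_ideal_nilradical[OF fd solv]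
  then have ideal: "lie_ideal nilradical" by (simp add: nilpotent_ideal_def)
  obtain ws where ws: "ordered_basis nilradical ws" "ad_flag ws"
    by (rule exists_ad_flag_basis[OF fd solv ideal])
  then have W: "?W = diagonal_functionals V ws"
    using upper_triangular_iff_ad_flag[OF ideal ws(1)]
    by (intro nilradical_weights_eq[OF fd solv fs]) (simp add: triangularizing_basis_def)
  have fsV: "set fs \<subseteq> V" and subV: "subspace V"
    using fs span_superset by (auto simp: ordered_basis_def)
  have xsN: "set xs \<subseteq> nilradical" using xs span_superset by (auto simp: ordered_basis_def)
  have "char_polynomial (xs @ fs) = indet 0 ^ length fs * det (ad_pencil xs (xs @ fs))"
    unfolding char_polynomial_eq_det_ad_pencil
    by (rule det_ad_pencil_block[OF xs bracket_in_nilradical[OF fd solv] fs V])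
  also have "det (ad_pencil xs (xs @ fs)) = det (ad_pencil ws (xs @ fs))"
    by (rule det_ad_pencil_change_of_basis[OF ideal xs ws(1)])
  also have "\<dots> = prod_mset (image_mset ?L ?W)"
    unfolding W by (rule det_ad_pencil_triangular[OF nilp ws xsN fsV])
  finally have Q: "char_polynomial (xs @ fs) = indet 0 ^ length fs * prod_mset (image_mset ?L ?W)" .
  then show "char_polynomial (xs @ fs) = indet 0 ^ dim V *
      (\<Prod>\<alpha>\<in>set_mset ?W. (indet 0 + weight_form xs fs \<alpha>) ^ count ?W \<alpha>)"
    using length_ordered_basis[OF fs] by (simp add: image_prod_mset_multiplicity monic_weight_form_def)
  have L0: "?L ?zero = indet 0"
  proof -
    have "?zero (fs ! j) = 0" if "j < length fs" for j
      using fsV nth_mem[OF that] by auto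
    then show ?thesis by (simp add: monic_weight_form_def weight_form_def)
  qed
  define W' where "W' = replicate_mset (length fs) ?zero + ?W"
  have QW': "char_polynomial (xs @ fs) = prod_mset (image_mset ?L W')"
    by (simp add: Q W'_def L0)
  have "dual_element V ?zero" using subV by (simp add: dual_element_def subspace_add subspace_scale)
  then have dual: "dual_element V \<alpha>" if "\<alpha> \<in># W'" for \<alpha>
    using that dual_element_diagonal_functionals[OF ideal ws(1) subV, of \<alpha>]
    by (auto simp: W'_def W split: if_splits)
  \<comment> \<open>If \<open>V\<close> is trivial, \<open>W'\<close> has no added copies of the zero functional, but then the nilradical is the whole
      algebra, so there is a weight, and it lives on the zero space.\<close>
  have "?zero \<in># W'"
  proof (cases "fs = []")
    case False
    then show ?thesis by (simp add: W'_def)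
  next
    case True
    then have V0: "V = {0}" using fs by (simp add: ordered_basis_def)
    then have "nilradical = UNIV" using V by (auto simp: complement_of_def)
    then have "ws \<noteq> []" using ws(1) nontrivial by (auto simp: ordered_basis_def)
    then have "restrict (\<lambda>y. ad_matrix ws y $$ (0, 0)) V \<in># ?W"
      by (auto simp: W diagonal_functionals_def)
    moreover from this have "restrict (\<lambda>y. ad_matrix ws y $$ (0, 0)) V = ?zero"
      using dual True by (intro dual_element_eqI[OF _ \<open>dual_element V ?zero\<close> fs]) (auto simp: W'_def)
    ultimately show ?thesis by (simp add: W'_def)
  qed
  then have "set_mset W' = set_mset ?W \<union> {?zero}" by (auto simp: W'_def split: if_splits)
  moreover have "num_irreducible_factors (prod_mset (image_mset ?L W')) = card (set_mset W')"
    using monic_weight_form_multiple_eq[OF dual dual fs]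
    by (intro num_irreducible_factors_prod_primes prime_elem_monic_weight_form) blast
  ultimately show "spectral_index (xs @ fs) = card (set_mset ?W \<union> {?zero})"
    by (simp add: spectral_index_def QW')
qed

end

theorem theorem3p4:
  fixes scale :: "complex \<Rightarrow> 's::ab_group_add \<Rightarrow> 's"
    and bracket :: "'s \<Rightarrow> 's \<Rightarrow> 's"
    and V :: "'s set"
    and xs fs :: "'s list"
    and \<Delta> :: "('s \<Rightarrow> complex) set"
    and m :: "('s \<Rightarrow> complex) \<Rightarrow> nat"
  assumes "complex_lie_algebra scale bracket"
    and "complex_lie_algebra.finite_dimensional scale"
    and "complex_lie_algebra.solvable scale bracket"
    and "(UNIV :: 's set) \<noteq> {0}"
    and "complex_lie_algebra.complement_of scale
           (complex_lie_algebra.nilradical scale bracket) V"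
    and "complex_lie_algebra.ordered_basis scale
           (complex_lie_algebra.nilradical scale bracket) xs"
    and "complex_lie_algebra.ordered_basis scale V fs"
    and "\<Delta> = set_mset (complex_lie_algebra.nilradical_weights scale bracket V)"
    and "m = count (complex_lie_algebra.nilradical_weights scale bracket V)"
  shows "complex_lie_algebra.char_polynomial scale bracket (xs @ fs) =
           indet 0 ^ vector_space.dim scale V *
           (\<Prod>\<alpha>\<in>\<Delta>. (indet 0 + weight_form xs fs \<alpha>) ^ m \<alpha>)
       \<and> complex_lie_algebra.spectral_index scale bracket (xs @ fs) =
           card (\<Delta> \<union> {restrict (\<lambda>_. 0) V})"
proof -
  interpret complex_lie_algebra scale bracket by (rule assms(1))
  show ?thesis
    using char_polynomial_and_spectral_index[OF assms(2-7)] by (simp add: assms(8,9))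
qed

end
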